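(* Let $H=(\mathcal X,\mathcal F,\mathcal G,\varphi,r)$ be a topological hybrid system with $\mathcal X$ Hausdorff that is deterministic and such that for every $x\in\mathcal X$ there is an infinite or Zeno execution starting at $x$. Let $\Sigma_H,\pi_0,\iota,\pi$ be as defined in the context. Then there exists a continuous semiflow $\Phi\colon[0,\infty)\times\Sigma_H\to\Sigma_H$ satisfying (1) $\Phi^t(\pi\circ\pi_0(z,s))=\pi\circ\pi_0(z,t+s)$ for all $z\in\mathcal G$, $s\in[0,1]$, and $t\in[0,1-s]$, and (2) $\pi\circ\iota(\varphi^t(x))=\Phi^t(\pi\circ\iota(x))$ for all $(t,x)\in\mathrm{dom}(\varphi)$, if and only if $H$ satisfies the trapping guard condition.
   Context: **Hybrid systems.** A local semiflow $\varphi$ on a topological space $\mathcal F$ is a map $\varphi\colon\mathrm{dom}(\varphi)\to\mathcal F$ defined on an open neighborhood $\mathrm{dom}(\varphi)\subseteq[0,\infty)\times\mathcal F$ of $\{0\}\times\mathcal F$ such that, writing $\varphi^t=\varphi(t,\cdot)$, for $t,s\ge 0$: (i) $\varphi^0=\mathrm{id}_{\mathcal F}$; (ii) $(t+s,x)\in\mathrm{dom}(\varphi)$ iff both $(s,x)\in\mathrm{dom}(\varphi)$ and $(t,\varphi^s(x))\in\mathrm{dom}(\varphi)$; (iii) $\varphi^{t+s}(x)=\varphi^t(\varphi^s(x))$ for all $(t+s,x)\in\mathrm{dom}(\varphi)$. It is a semiflow if $\mathrm{dom}(\varphi)=[0,\infty)\times\mathcal F$. A topological hybrid system (THS) $H=(\mathcal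 X,\mathcal F,\mathcal G,\varphi,r)$ consists of a topological space $\mathcal X$ (state space), an open set $\mathcal F\subseteq\mathcal X$ (flow set) with a continuous local semiflow $\varphi$ on $\mathcal F$, a closed set $\mathcal G\subseteq\mathcal X$ (guard), and a continuous map $r\colon\mathcal G\to\mathcal X$ (reset). **Executions.** An execution in $H$ is a tuple $\chi=(N,\tau,\gamma)$ with $N\in\mathbb N_{\ge0}\cup\{+\infty\}$; a nondecreasing sequence $\tau=(\tau_j)_{j=0}^{N+1}\subseteq\mathbb R\cup\{+\infty\}$ with $\tau_0=0$ and $(\tau_j)_{j=0}^N\subseteq\mathbb R$; and continuous maps $\gamma_j\colon T_j\to\mathcal X$ ($0\le j<N+1$) with $[\tau_j,\tau_{j+1})\subseteq T_j\subseteq[\tau_j,\tau_{j+1}]\cap\mathbb R$, such that $\gamma_j([\tau_j,\tau_{j+1}))\subseteq\mathcal F$ and $\gamma_j|_{[\tau_j,\tau_{j+1})}$ is a trajectory segment of $\varphi$ (i.e. $\gamma_j(t)=\varphi^{t-\tau_j}(\gamma_j(\tau_j))$); for $0\le j<N$ one additionally requires $T_j=[\tau_j,\tau_{j+1}]$, $\gamma_j(\tau_{j+1})\in\mathcal G$ and $\gamma_{j+1}(\tau_{j+1})=r(\gamma_j(\tau_{j+1}))$. (If $\tau_j=\tau_{j+1}$ the $\mathcal F$-condition is vacuous.) It starts at $\gamma_0(0)$. Its stop time is $\tau_{N+1}$ if $N<\infty$ and $\lim_{j\to\infty}\tau_j$ if $N=\infty$. It is infinite if the stop time is infinite, and Zeno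 if the stop time is finite and $N=\infty$. **Assumption terminology.** $H$ is deterministic if $\mathcal G\cap\mathcal F=\varnothing$. The maximum flow time $\mu\colon\mathcal X\to[0,+\infty]$ is $\mu(x)=\sup\{t\ge0:(t,x)\in\mathrm{dom}(\varphi)\}$ for $x\in\mathcal F$ and $\mu(x)=0$ for $x\notin\mathcal F$. A deterministic THS satisfies the trapping guard condition if there are a neighborhood $U\subseteq\mathcal X$ of $\mathcal G$ and a continuous retraction $\rho\colon U\to\mathcal G$ ($\rho|_{\mathcal G}=\mathrm{id}$) such that (i) $\mu|_U$ is a continuous real-valued function and (ii) with $\mathrm{cl}(\mathrm{dom}(\varphi))$ the closure of $\mathrm{dom}(\varphi)$ in $[0,\infty)\times\mathcal X$, the map $\varphi|_{\mathrm{dom}(\varphi)\cap([0,\infty)\times U)}$ admits a unique continuous extension $\widehat\varphi$ to $\mathrm{cl}(\mathrm{dom}(\varphi))\cap([0,\infty)\times U)$, given by $\widehat\varphi(t,x)=\varphi^t(x)$ if $(t,x)\in\mathrm{dom}(\varphi)$, $x\in U$, and $\widehat\varphi(t,x)=\rho(x)$ if $x\in U$, $t=\mu(x)$. **Gluing construction (for an arbitrary THS).** $\mathcal X'$ is the quotient space of the disjoint union $\mathcal X\sqcup(\mathcal G\times[0,1])$ by the equivalence relation identifying each $z\in\mathcal G\subseteq\mathcal X$ with $(z,0)$; $\pi_0\colon\mathcal X\sqcup(\mathcal G\times[0,1])\to\mathcal X'$ is the quotient map and $\iota=\pi_0|_{\mathcal X}\colon\mathcal X\to\mathcal X'$. $\Sigma_H$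 is the quotient space of $\mathcal X'$ by the equivalence relation identifying $\pi_0(z,1)$ with $\pi_0(r(z))$ for each $z\in\mathcal G$, with quotient map $\pi\colon\mathcal X'\to\Sigma_H$. *)

theory Defs
  imports "HOL-Analysis.Analysis"
begin

section \<open>Binary disjoint unions and quotient spaces\<close>

definition disjoint_union_topology ::
    "'a topology \<Rightarrow> 'b topology \<Rightarrow> ('a + 'b) topology" where
  "disjoint_union_topology S T =
     topology (\<lambda>W. W \<subseteq> topspace S <+> topspace T \<and> openin S (Inl -` W) \<and> openin T (Inr -` W))"

lemma openin_disjoint_union_topology:
  "openin (disjoint_union_topology S T) W \<longleftrightarrow>
     W \<subseteq> topspace S <+> topspace T \<and> openin S (Inl -` W) \<and> openin T (Inr -` W)"
proof -
  have "istopology (\<lambda>W. W \<subseteq> topspace S <+> topspace T \<and> openin S (Inl -` W) \<and> openin T (Inr -` W))"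
    unfolding istopology_def
    by (auto simp: vimage_Int vimage_Union)
  then show ?thesis
    by (simp add: disjoint_union_topology_def topology_inverse')
qed

lemma topspace_disjoint_union_topology [simp]:
  "topspace (disjoint_union_topology S T) = topspace S <+> topspace T"
proof (rule antisym)
  have "Inl -` (topspace S <+> topspace T) = topspace S"
    and "Inr -` (topspace S <+> topspace T) = topspace T"
    by auto
  then have "openin (disjoint_union_topology S T) (topspace S <+> topspace T)"
    by (simp add: openin_disjoint_union_topology)
  then show "topspace S <+> topspace T \<subseteq> topspace (disjoint_union_topology S T)"
    by (rule openin_subset)
next
  show "topspace (disjoint_union_topology S T) \<subseteq> topspace S <+> topspace T"
    using openin_disjoint_union_topology openin_topspace by blast
qed

text \<open>For \<open>R \<subseteq> A \<times> A\<close> this is the least equivalence relation on \<open>A\<close> containing \<open>R\<close>;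
  see \<open>equiv_generated_equiv\<close>, \<open>generated_equiv_least\<close>.\<close>

definition generated_equiv :: "'a set \<Rightarrow> ('a \<times> 'a) set \<Rightarrow> ('a \<times> 'a) set" where
  "generated_equiv A R = (R \<union> R\<inverse>)\<^sup>* \<inter> A \<times> A"

lemma equiv_generated_equiv: "equiv A (generated_equiv A R)"
proof (rule equivI)
  show "generated_equiv A R \<subseteq> A \<times> A" "refl_on A (generated_equiv A R)"
    by (auto simp: generated_equiv_def refl_on_def)
  have "sym ((R \<union> R\<inverse>)\<^sup>*)"
    by (rule sym_rtrancl) (auto simp: sym_def)
  then show "sym (generated_equiv A R)"
    by (auto simp: generated_equiv_def sym_def)
  show "trans (generated_equiv A R)"
    by (auto simp: generated_equiv_def trans_def intro: rtrancl_trans)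
qed

lemma generated_equiv_contains: "R \<subseteq> A \<times> A \<Longrightarrow> R \<subseteq> generated_equiv A R"
  by (auto simp: generated_equiv_def)

lemma generated_equiv_least:
  assumes E: "equiv A E" and "R \<subseteq> E"
  shows "generated_equiv A R \<subseteq> E"
proof clarify
  fix x y assume "(x, y) \<in> generated_equiv A R"
  then have xy: "(x, y) \<in> (R \<union> R\<inverse>)\<^sup>*" and "x \<in> A"
    by (auto simp: generated_equiv_def)
  from xy show "(x, y) \<in> E"
  proof (induction rule: rtrancl_induct)
    case base
    then show ?case using E \<open>x \<in> A\<close> by (auto simp: equiv_def refl_on_def)
  next
    case (step y z)
    then have "(y, z) \<in> E"
      using assms by (auto simp: equiv_def dest: symD)
    with step.IH show ?case
      using E by (auto simp: equiv_def dest: transD)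
  qed
qed

definition quotient_topology :: "'a topology \<Rightarrow> ('a \<times> 'a) set \<Rightarrow> 'a set topology" where
  "quotient_topology T E =
     topology (\<lambda>W. W \<subseteq> topspace T // E \<and> openin T {x \<in> topspace T. Equiv_Relations.proj E x \<in> W})"

lemma openin_quotient_topology:
  "openin (quotient_topology T E) W \<longleftrightarrow>
     W \<subseteq> topspace T // E \<and> openin T {x \<in> topspace T. Equiv_Relations.proj E x \<in> W}"
proof -
  have *: "{x \<in> topspace T. Equiv_Relations.proj E x \<in> \<Union>\<K>} = (\<Union>K\<in>\<K>. {x \<in> topspace T. Equiv_Relations.proj E x \<in> K})" for \<K>
    by auto
  have **: "{x \<in> topspace T. Equiv_Relations.proj E x \<in> K \<inter> L} =
      {x \<in> topspace T. Equiv_Relations.proj E x \<in> K} \<inter> {x \<in> topspace T. Equiv_Relations.proj E x \<in> L}" for K L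
    by auto
  have "istopology (\<lambda>W. W \<subseteq> topspace T // E \<and> openin T {x \<in> topspace T. Equiv_Relations.proj E x \<in> W})"
    unfolding istopology_def * ** by blast
  then show ?thesis
    by (simp add: quotient_topology_def topology_inverse')
qed

lemma topspace_quotient_topology [simp]:
  "topspace (quotient_topology T E) = topspace T // E"
proof (rule antisym)
  have "{x \<in> topspace T. Equiv_Relations.proj E x \<in> topspace T // E} = topspace T"
    by (auto simp: Equiv_Relations.proj_def quotientI)
  then have "openin (quotient_topology T E) (topspace T // E)"
    by (simp add: openin_quotient_topology)
  then show "topspace T // E \<subseteq> topspace (quotient_topology T E)"
    by (rule openin_subset)
next
  show "topspace (quotient_topology T E) \<subseteq> topspace T // E"
    using openin_quotient_topology openin_topspace by blast
qed

lemma quotient_map_proj: "quotient_map T (quotient_topology T E) (Equiv_Relations.proj E)"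
proof -
  have "Equiv_Relations.proj E ` topspace T = topspace T // E"
    by (auto simp: Equiv_Relations.proj_def quotient_def)
  then show ?thesis
    by (auto simp: quotient_map_def openin_quotient_topology)
qed


section \<open>Local semiflows and topological hybrid systems\<close>

abbreviation nonneg_times :: "'a topology \<Rightarrow> (real \<times> 'a) topology" where
  "nonneg_times T \<equiv> prod_topology (top_of_set {0..}) T"

definition local_semiflow ::
    "'a topology \<Rightarrow> (real \<times> 'a) set \<Rightarrow> (real \<Rightarrow> 'a \<Rightarrow> 'a) \<Rightarrow> bool" where
  "local_semiflow T D \<phi> \<longleftrightarrow>
     openin (nonneg_times T) D \<and> {0} \<times> topspace T \<subseteq> D \<and>
     (\<forall>(t, x) \<in> D. \<phi> t x \<in> topspace T) \<and>
     (\<forall>x \<in> topspace T. \<phi> 0 x = x) \<and>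
     (\<forall>t\<ge>0. \<forall>s\<ge>0. \<forall>x \<in> topspace T.
        (t + s, x) \<in> D \<longleftrightarrow> (s, x) \<in> D \<and> (t, \<phi> s x) \<in> D) \<and>
     (\<forall>t\<ge>0. \<forall>s\<ge>0. \<forall>x. (t + s, x) \<in> D \<longrightarrow> \<phi> (t + s) x = \<phi> t (\<phi> s x))"

definition continuous_local_semiflow ::
    "'a topology \<Rightarrow> (real \<times> 'a) set \<Rightarrow> (real \<Rightarrow> 'a \<Rightarrow> 'a) \<Rightarrow> bool" where
  "continuous_local_semiflow T D \<phi> \<longleftrightarrow>
     local_semiflow T D \<phi> \<and>
     continuous_map (subtopology (nonneg_times T) D) T (\<lambda>(t, x). \<phi> t x)"

definition continuous_semiflow :: "'a topology \<Rightarrow> (real \<Rightarrow> 'a \<Rightarrow> 'a) \<Rightarrow> bool" where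
  "continuous_semiflow T \<phi> \<longleftrightarrow> continuous_local_semiflow T ({0..} \<times> topspace T) \<phi>"

text \<open>The values of \<open>flow\<close> outside \<open>flow_dom\<close> and of \<open>reset\<close> outside \<open>guard\<close> are irrelevant.\<close>

record 'a hybrid_system =
  state_space :: "'a topology"
  flow_set :: "'a set"
  guard :: "'a set"
  flow_dom :: "(real \<times> 'a) set"
  flow :: "real \<Rightarrow> 'a \<Rightarrow> 'a"
  reset :: "'a \<Rightarrow> 'a"

definition topological_hybrid_system :: "'a hybrid_system \<Rightarrow> bool" where
  "topological_hybrid_system H \<longleftrightarrow>
     openin (state_space H) (flow_set H) \<and>
     continuous_local_semiflow (subtopology (state_space H) (flow_set H)) (flow_dom H) (flow H) \<and>
     closedin (state_space H) (guard H) \<and>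
     continuous_map (subtopology (state_space H) (guard H)) (state_space H) (reset H)"

definition deterministic :: "'a hybrid_system \<Rightarrow> bool" where
  "deterministic H \<longleftrightarrow> guard H \<inter> flow_set H = {}"


section \<open>Executions\<close>

text \<open>\<open>traj_dom e j\<close> is the domain of the partial function \<open>traj e j\<close>. Only the entries
  \<open>jump_time e j\<close> with \<open>j \<le> jumps e + 1\<close> and \<open>traj e j\<close> with \<open>j < jumps e + 1\<close> are meaningful.\<close>

record 'a execution =
  jumps :: enat
  jump_time :: "nat \<Rightarrow> ereal"
  traj_dom :: "nat \<Rightarrow> real set"
  traj :: "nat \<Rightarrow> real \<Rightarrow> 'a"

text \<open>The membership \<open>b \<in> traj_dom e (Suc j)\<close> is what makes the evaluation of the next trajectory at \<open>b\<close>
  meaningful: a last trajectory with two equal end times could otherwise have empty domain.\<close>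

definition is_execution :: "'a hybrid_system \<Rightarrow> 'a execution \<Rightarrow> bool" where
  "is_execution H e \<longleftrightarrow>
     jump_time e 0 = 0 \<and>
     (\<forall>j. enat j < jumps e + 1 \<longrightarrow> jump_time e j \<le> jump_time e (Suc j)) \<and>
     (\<forall>j. enat j \<le> jumps e \<longrightarrow> \<bar>jump_time e j\<bar> \<noteq> \<infinity>) \<and>
     (\<forall>j. enat j < jumps e + 1 \<longrightarrow>
        (let a = real_of_ereal (jump_time e j);
             I = {t. jump_time e j \<le> ereal t \<and> ereal t < jump_time e (Suc j)}
         in I \<subseteq> traj_dom e j \<and>
            traj_dom e j \<subseteq> {t. jump_time e j \<le> ereal t \<and> ereal t \<le> jump_time e (Suc j)} \<and>
            continuous_map (top_of_set (traj_dom e j)) (state_space H) (traj e j) \<and>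
            traj e j ` I \<subseteq> flow_set H \<and>
            (\<forall>t\<in>I. (t - a, traj e j a) \<in> flow_dom H \<and> traj e j t = flow H (t - a) (traj e j a)))) \<and>
     (\<forall>j. enat j < jumps e \<longrightarrow>
        (let b = real_of_ereal (jump_time e (Suc j))
         in traj_dom e j = {real_of_ereal (jump_time e j)..b} \<and>
            traj e j b \<in> guard H \<and>
            b \<in> traj_dom e (Suc j) \<and> traj e (Suc j) b = reset H (traj e j b)))"

definition starts_at :: "'a execution \<Rightarrow> 'a \<Rightarrow> bool" where
  "starts_at e x \<longleftrightarrow> 0 \<in> traj_dom e 0 \<and> traj e 0 0 = x"

definition stop_time :: "'a execution \<Rightarrow> ereal" where
  "stop_time e = (case jumps e of enat n \<Rightarrow> jump_time e (Suc n) | \<infinity> \<Rightarrow> lim (jump_time e))"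

definition infinite_execution :: "'a execution \<Rightarrow> bool" where
  "infinite_execution e \<longleftrightarrow> stop_time e = \<infinity>"

definition zeno_execution :: "'a execution \<Rightarrow> bool" where
  "zeno_execution e \<longleftrightarrow> stop_time e < \<infinity> \<and> jumps e = \<infinity>"


section \<open>The trapping guard condition\<close>

definition max_flow_time :: "'a hybrid_system \<Rightarrow> 'a \<Rightarrow> ereal" where
  "max_flow_time H x =
     (if x \<in> flow_set H then Sup {ereal t | t. t \<ge> 0 \<and> (t, x) \<in> flow_dom H} else 0)"

definition neighborhood_of_set :: "'a topology \<Rightarrow> 'a set \<Rightarrow> 'a set \<Rightarrow> bool" where
  "neighborhood_of_set T S U \<longleftrightarrow> U \<subseteq> topspace T \<and> (\<exists>W. openin T W \<and> S \<subseteq> W \<and> W \<subseteq> U)"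

text \<open>\<open>\<psi>\<close> is a continuous extension to \<open>C\<close> of the restriction of the flow to \<open>C \<inter> flow_dom H\<close>.\<close>

definition continuous_flow_extension ::
    "'a hybrid_system \<Rightarrow> (real \<times> 'a) set \<Rightarrow> (real \<times> 'a \<Rightarrow> 'a) \<Rightarrow> bool" where
  "continuous_flow_extension H C \<psi> \<longleftrightarrow>
     continuous_map (subtopology (nonneg_times (state_space H)) C) (state_space H) \<psi> \<and>
     (\<forall>(t, x) \<in> C \<inter> flow_dom H. \<psi> (t, x) = flow H t x)"

text \<open>With \<open>C\<close> as below, \<open>C \<inter> flow_dom H = flow_dom H \<inter> ({0..} \<times> U)\<close>, since \<open>flow_dom H\<close> is
  contained in its closure.\<close>

definition trapping_guard :: "'a hybrid_system \<Rightarrow> bool" where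
  "trapping_guard H \<longleftrightarrow>
     (\<exists>U \<rho>. neighborhood_of_set (state_space H) (guard H) U \<and>
        retraction_maps (subtopology (state_space H) U) (subtopology (state_space H) (guard H)) \<rho> id \<and>
        (\<forall>x\<in>U. max_flow_time H x \<noteq> \<infinity>) \<and>
        continuous_map (subtopology (state_space H) U) euclideanreal
          (\<lambda>x. real_of_ereal (max_flow_time H x)) \<and>
        (let C = (nonneg_times (state_space H) closure_of flow_dom H) \<inter> ({0..} \<times> U)
         in \<exists>\<psi>. continuous_flow_extension H C \<psi> \<and>
              (\<forall>\<psi>'. continuous_flow_extension H C \<psi>' \<longrightarrow> (\<forall>p\<in>C. \<psi>' p = \<psi> p)) \<and>
              (\<forall>(t, x) \<in> C. ((t, x) \<in> flow_dom H \<longrightarrow> \<psi> (t, x) = flow H t x) \<and>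
                            (ereal t = max_flow_time H x \<longrightarrow> \<psi> (t, x) = \<rho> x))))"


section \<open>The gluing construction\<close>

definition cylinder_sum :: "'a hybrid_system \<Rightarrow> ('a + 'a \<times> real) topology" where
  "cylinder_sum H =
     disjoint_union_topology (state_space H)
       (prod_topology (subtopology (state_space H) (guard H)) (top_of_set {0..1}))"

definition collar_equiv ::
    "'a hybrid_system \<Rightarrow> (('a + 'a \<times> real) \<times> ('a + 'a \<times> real)) set" where
  "collar_equiv H =
     generated_equiv (topspace (cylinder_sum H)) {(Inl z, Inr (z, 0)) | z. z \<in> guard H}"

definition collared_space :: "'a hybrid_system \<Rightarrow> ('a + 'a \<times> real) set topology" where
  "collared_space H = quotient_topology (cylinder_sum H) (collar_equiv H)"

definition pi0 :: "'a hybrid_system \<Rightarrow> 'a + 'a \<times> real \<Rightarrow> ('a + 'a \<times> real) set" where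
  "pi0 H = Equiv_Relations.proj (collar_equiv H)"

definition iota :: "'a hybrid_system \<Rightarrow> 'a \<Rightarrow> ('a + 'a \<times> real) set" where
  "iota H = pi0 H \<circ> Inl"

definition suspension_equiv ::
    "'a hybrid_system \<Rightarrow> (('a + 'a \<times> real) set \<times> ('a + 'a \<times> real) set) set" where
  "suspension_equiv H =
     generated_equiv (topspace (collared_space H))
       {(pi0 H (Inr (z, 1)), pi0 H (Inl (reset H z))) | z. z \<in> guard H}"

definition suspension :: "'a hybrid_system \<Rightarrow> ('a + 'a \<times> real) set set topology" where
  "suspension H = quotient_topology (collared_space H) (suspension_equiv H)"

definition pi_susp ::
    "'a hybrid_system \<Rightarrow> ('a + 'a \<times> real) set \<Rightarrow> ('a + 'a \<times> real) set set" where
  "pi_susp H = Equiv_Relations.proj (suspension_equiv H)"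

end

theory Submission
  imports Defs
begin

text \<open>
  Three facts about the suspension \<open>\<Sigma>\<close> carry everything. It is a single quotient of the disjoint union
  of the state space \<open>X\<close> and the cylinder \<open>G \<times> [0,1]\<close>, and a function respecting the two gluings is
  constant on the fibres of the quotient map \<open>q\<close> (\<open>q_eqD\<close>). The open cylinder \<open>G \<times> (0,1)\<close> is an open
  subset of \<open>\<Sigma>\<close> with continuous coordinates (\<open>open_cylinder_chart\<close>). Its complement is the image of \<open>X\<close>,
  and a neighbourhood of that image retracts continuously onto \<open>X\<close>: push the lower half of the cylinder
  down to \<open>z\<close> and the upper half up to the reset of \<open>z\<close> (\<open>state_space_neighbourhood_retract\<close>).

  The existence of infinite or Zeno executions says that every point lies in the flow set or in the
  guard, and that an orbit which leaves the flow set after a finite time \<open>\<mu> x\<close> converges to a point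
  \<open>endpoint x\<close> of the guard (\<open>endpoint_path\<close>). So there is only one candidate for the suspension flow
  started at \<open>x \<in> X\<close>: follow \<open>\<phi>\<close> until \<open>\<mu> x\<close>, then climb the cylinder over \<open>endpoint x\<close>. For times in
  \<open>[0,1]\<close> this is the function \<open>advance\<close>; climbing takes unit time, so no second visit to the guard
  interferes. Both sides of the theorem are equivalent to the continuity of \<open>advance\<close> on \<open>[0,1] \<times> X\<close>.

  A suspension semiflow exists iff \<open>advance\<close> is continuous. A semiflow with the two
  properties must equal \<open>advance\<close>; the only delicate moment is the hitting time, where the limit of the
  orbit has to be identified inside \<open>\<Sigma>\<close> (\<open>suspends_hits_endpoint\<close>). Conversely, \<open>advance\<close> extends over the
  cylinder to a continuous map from the product of \<open>[0,1]\<close> and the disjoint union to \<open>\<Sigma>\<close>, which descends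
  to a unit-time semiflow on \<open>\<Sigma>\<close> because \<open>[0,1]\<close> is locally compact Hausdorff, so that the product of
  \<open>q\<close> with the identity of \<open>[0,1]\<close> is again a quotient map; iterating the time-one map then gives all times (\<open>unit_time_extends_to_semiflow\<close>).

  The trapping guard condition holds iff \<open>advance\<close> is continuous. If \<open>advance\<close> is continuous, the points
  that are inside the open cylinder at time \<open>1/2\<close> form an open neighbourhood of the guard, and the two
  cylinder coordinates of \<open>advance (1/2) x\<close> are \<open>endpoint x\<close> and \<open>1/2 - \<mu> x\<close>; so the retraction and \<open>\<mu>\<close>
  are continuous, and the neighbourhood retraction onto \<open>X\<close> turns \<open>advance\<close> into the extended flow.
  Conversely, the trapping guard condition gives continuity near the guard, and the flow
  carries it backwards along every orbit that ever reaches the guard.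
\<close>

section \<open>Continuity from open and from closed covers\<close>

lemma continuous_map_comp:
  "continuous_map Z X g \<Longrightarrow> continuous_map X Y f \<Longrightarrow> continuous_map Z Y (\<lambda>z. f (g z))"
  using continuous_map_compose[of Z X g Y f] by (simp add: o_def)

lemma continuous_map_locally:
  assumes "\<And>z. z \<in> topspace Z \<Longrightarrow>
      \<exists>V. openin Z V \<and> z \<in> V \<and> continuous_map (subtopology Z V) Y f"
  shows "continuous_map Z Y f"
  by (rule pasting_lemma[where I = "{V. openin Z V \<and> continuous_map (subtopology Z V) Y f}"
        and T = id and f = "\<lambda>_. f"]) (use assms in auto)

lemma continuous_map_two_closed:
  assumes "closedin Z A" "closedin Z B" "topspace Z \<subseteq> A \<union> B"
    and "continuous_map (subtopology Z A) Y f" "continuous_map (subtopology Z B) Y f"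
  shows "continuous_map Z Y f"
  by (rule pasting_lemma_closed[where I = "{A, B}" and T = id and f = "\<lambda>_. f"])
     (use assms in auto)

lemma openin_real_greater:
  assumes "continuous_map Z euclideanreal f" "continuous_map Z euclideanreal g"
  shows "openin Z {z \<in> topspace Z. f z < g z}"
proof -
  have "openin Z {z \<in> topspace Z. g z - f z \<in> {0<..}}"
    by (rule openin_continuous_map_preimage[where Y = euclideanreal])
       (auto intro!: continuous_map_diff assms)
  then show ?thesis by simp
qed

lemma closedin_real_le:
  assumes "continuous_map Z euclideanreal f" "continuous_map Z euclideanreal g"
  shows "closedin Z {z \<in> topspace Z. f z \<le> g z}"
proof -
  have "closedin Z {z \<in> topspace Z. g z - f z \<in> {0..}}"
    by (rule closedin_continuous_map_preimage[where Y = euclideanreal])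
       (auto intro!: continuous_map_diff assms)
  then show ?thesis by simp
qed

lemma continuous_map_fst_real: "continuous_map (prod_topology (top_of_set S) Y) euclideanreal fst"
  using continuous_map_fst continuous_map_into_fulltopology by blast

lemma openin_Inl_image:
  fixes S :: "'a topology" and T :: "'b topology"
  assumes "openin S U" shows "openin (disjoint_union_topology S T) (Inl ` U)"
proof -
  have "(Inl :: 'a \<Rightarrow> 'a + 'b) -` Inl ` U = U" "(Inr :: 'b \<Rightarrow> 'a + 'b) -` Inl ` U = {}"
    by auto
  with assms openin_subset[OF assms] show ?thesis
    by (auto simp: openin_disjoint_union_topology)
qed

lemma openin_Inr_image:
  fixes S :: "'a topology" and T :: "'b topology"
  assumes "openin T U" shows "openin (disjoint_union_topology S T) (Inr ` U)"
proof -
  have "(Inr :: 'b \<Rightarrow> 'a + 'b) -` Inr ` U = U" "(Inl :: 'a \<Rightarrow> 'a + 'b) -` Inr ` U = {}"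
    by auto
  with assms openin_subset[OF assms] show ?thesis
    by (auto simp: openin_disjoint_union_topology)
qed

lemma continuous_map_Inl: "continuous_map S (disjoint_union_topology S T) Inl"
  unfolding continuous_map openin_disjoint_union_topology
proof (intro conjI allI impI)
  fix U assume U: "U \<subseteq> topspace S <+> topspace T \<and> openin S (Inl -` U) \<and> openin T (Inr -` U)"
  moreover from U have "{x \<in> topspace S. Inl x \<in> U} = Inl -` U" by auto
  ultimately show "openin S {x \<in> topspace S. Inl x \<in> U}" by simp
qed auto

lemma continuous_map_Inr: "continuous_map T (disjoint_union_topology S T) Inr"
  unfolding continuous_map openin_disjoint_union_topology
proof (intro conjI allI impI)
  fix U assume U: "U \<subseteq> topspace S <+> topspace T \<and> openin S (Inl -` U) \<and> openin T (Inr -` U)"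
  moreover from U have "{x \<in> topspace T. Inr x \<in> U} = Inr -` U" by auto
  ultimately show "openin T {x \<in> topspace T. Inr x \<in> U}" by simp
qed auto

lemma continuous_map_projl:
  "continuous_map (subtopology (disjoint_union_topology S T) (Inl ` topspace S)) S projl"
  unfolding continuous_map
proof (intro conjI allI impI)
  fix U assume U: "openin S U"
  have "openin (disjoint_union_topology S T) (Inl ` U)"
    using U by (rule openin_Inl_image)
  moreover have "{x \<in> topspace (subtopology (disjoint_union_topology S T) (Inl ` topspace S)). projl x \<in> U}
      = Inl ` U \<inter> Inl ` topspace S"
    using openin_subset[OF U] by force
  ultimately show "openin (subtopology (disjoint_union_topology S T) (Inl ` topspace S))
      {x \<in> topspace (subtopology (disjoint_union_topology S T) (Inl ` topspace S)). projl x \<in> U}"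
    by (auto simp: openin_subtopology)
qed auto

lemma continuous_map_projr:
  "continuous_map (subtopology (disjoint_union_topology S T) (Inr ` topspace T)) T projr"
  unfolding continuous_map
proof (intro conjI allI impI)
  fix U assume U: "openin T U"
  have "openin (disjoint_union_topology S T) (Inr ` U)"
    using U by (rule openin_Inr_image)
  moreover have "{x \<in> topspace (subtopology (disjoint_union_topology S T) (Inr ` topspace T)). projr x \<in> U}
      = Inr ` U \<inter> Inr ` topspace T"
    using openin_subset[OF U] by force
  ultimately show "openin (subtopology (disjoint_union_topology S T) (Inr ` topspace T))
      {x \<in> topspace (subtopology (disjoint_union_topology S T) (Inr ` topspace T)). projr x \<in> U}"
    by (auto simp: openin_subtopology)
qed auto

text \<open>Products distribute over disjoint unions, so that a homotopy on the disjoint union may be checked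
  on the two summands. Each summand is open, and there the map factors through the projection.\<close>
lemma continuous_map_times_disjoint_union:
  assumes l: "continuous_map (prod_topology Z S) Y (\<lambda>(t, x). f (t, Inl x))"
    and r: "continuous_map (prod_topology Z T) Y (\<lambda>(t, p). f (t, Inr p))"
  shows "continuous_map (prod_topology Z (disjoint_union_topology S T)) Y f"
proof (rule continuous_map_locally)
  let ?U = "disjoint_union_topology S T"
  have l': "continuous_map (subtopology (prod_topology Z ?U) (topspace Z \<times> Inl ` topspace S)) Y f"
  proof (rule continuous_map_eq)
    show "continuous_map (subtopology (prod_topology Z ?U) (topspace Z \<times> Inl ` topspace S)) Y
        (\<lambda>p. (\<lambda>(t, x). f (t, Inl x)) (fst p, projl (snd p)))"
      unfolding subtopology_Times
      by (intro continuous_map_comp[OF _ l] continuous_map_pairedI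
          continuous_map_comp[OF continuous_map_snd continuous_map_projl])
         (simp add: continuous_map_fst)
  qed auto
  have r': "continuous_map (subtopology (prod_topology Z ?U) (topspace Z \<times> Inr ` topspace T)) Y f"
  proof (rule continuous_map_eq)
    show "continuous_map (subtopology (prod_topology Z ?U) (topspace Z \<times> Inr ` topspace T)) Y
        (\<lambda>p. (\<lambda>(t, x). f (t, Inr x)) (fst p, projr (snd p)))"
      unfolding subtopology_Times
      by (intro continuous_map_comp[OF _ r] continuous_map_pairedI
          continuous_map_comp[OF continuous_map_snd continuous_map_projr])
         (simp add: continuous_map_fst)
  qed auto
  fix z assume "z \<in> topspace (prod_topology Z ?U)"
  then have "z \<in> topspace Z \<times> Inl ` topspace S \<or> z \<in> topspace Z \<times> Inr ` topspace T"
    by auto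
  moreover have "openin (prod_topology Z ?U) (topspace Z \<times> Inl ` topspace S)"
    "openin (prod_topology Z ?U) (topspace Z \<times> Inr ` topspace T)"
    by (simp_all add: openin_prod_Times_iff openin_Inl_image openin_Inr_image)
  ultimately show "\<exists>V. openin (prod_topology Z ?U) V \<and> z \<in> V \<and>
      continuous_map (subtopology (prod_topology Z ?U) V) Y f"
    using l' r' by blast
qed

lemma right_end_in_closure:
  "a < b \<Longrightarrow> b \<in> top_of_set {a..b::real} closure_of {a..<b}"
  by (simp add: closure_of_subtopology Int_absorb1 atLeastLessThan_subseteq_atLeastAtMost_iff)

lemma open_meets_before_right_end:
  fixes f :: "real \<Rightarrow> 'a"
  assumes "a < b" "continuous_map (top_of_set {a..b}) Y f" "openin Y V" "f b \<in> V"
  obtains t where "a \<le> t" "t < b" "f t \<in> V"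
proof -
  let ?T = "{t \<in> topspace (top_of_set {a..b}). f t \<in> V}"
  have T: "openin (top_of_set {a..b}) ?T"
    by (rule openin_continuous_map_preimage[OF assms(2,3)])
  have "b \<in> ?T" using assms(1,4) by simp
  with T right_end_in_closure[OF assms(1)] obtain t where "t \<in> {a..<b}" "t \<in> ?T"
    by (meson in_closure_of)
  then show thesis using that by auto
qed

text \<open>Limits of orbits at the end of a half-open time interval are identified with this uniqueness
  principle.\<close>
lemma eq_at_right_end:
  fixes f g :: "real \<Rightarrow> 'a"
  assumes "Hausdorff_space Y" "a < b"
    and "continuous_map (top_of_set {a..b}) Y f" "continuous_map (top_of_set {a..b}) Y g"
    and "\<And>t. a \<le> t \<Longrightarrow> t < b \<Longrightarrow> f t = g t"
  shows "f b = g b"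
  by (rule forall_in_closure_of_eq[OF right_end_in_closure[OF assms(2)] assms(1,3,4)])
     (use assms(5) in auto)

section \<open>Extending unit-time semiflows\<close>

text \<open>The extension is \<open>\<Phi> t = \<Psi> (frac t) \<circ> (\<Psi> 1)^\<lfloor>t\<rfloor>\<close>. The maps \<open>\<Psi> a\<close> commute with \<open>\<Psi> 1 = \<Psi> a \<circ> \<Psi> (1 - a)\<close>,
  so integer and fractional parts may be collected separately; when the fractional parts overflow, one
  more factor \<open>\<Psi> 1\<close> is split off. Continuity holds because the formula on \<open>[n, n+1]\<close> also has the right
  value at the right end point.\<close>
lemma unit_time_extends_to_semiflow:
  fixes Y :: "'a topology"
  assumes cont: "continuous_map (prod_topology (top_of_set {0..1::real}) Y) Y (\<lambda>(t, y). \<Psi> t y)"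
    and zero: "\<And>y. y \<in> topspace Y \<Longrightarrow> \<Psi> 0 y = y"
    and add: "\<And>s t y. 0 \<le> s \<Longrightarrow> 0 \<le> t \<Longrightarrow> t + s \<le> 1 \<Longrightarrow> y \<in> topspace Y \<Longrightarrow>
                \<Psi> (t + s) y = \<Psi> t (\<Psi> s y)"
  obtains \<Phi> where "continuous_semiflow Y \<Phi>"
    "\<And>t y. 0 \<le> t \<Longrightarrow> t \<le> 1 \<Longrightarrow> y \<in> topspace Y \<Longrightarrow> \<Phi> t y = \<Psi> t y"
proof -
  have into: "\<Psi> t y \<in> topspace Y" if "0 \<le> t" "t \<le> 1" "y \<in> topspace Y" for t y
    using continuous_map_image_subset_topspace[OF cont] that by (auto simp: image_subset_iff)
  define P where "P n y = (\<Psi> 1 ^^ n) y" for n y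
  have P0: "P 0 y = y" and PS: "P (Suc n) y = \<Psi> 1 (P n y)" for n y
    by (simp_all add: P_def)
  have P_into: "P n y \<in> topspace Y" if "y \<in> topspace Y" for n y
    by (induction n) (use that in \<open>auto simp: P0 PS into\<close>)
  have PP: "P n (P m y) = P (n + m) y" for n m y
    by (simp add: P_def funpow_add)
  have comm1: "\<Psi> 1 (\<Psi> a y) = \<Psi> a (\<Psi> 1 y)" if "0 \<le> a" "a \<le> 1" "y \<in> topspace Y" for a y
    using add[of "1 - a" a "\<Psi> a y"] add[of a "1 - a" y] that into by simp
  have comm: "P n (\<Psi> a y) = \<Psi> a (P n y)" if "0 \<le> a" "a \<le> 1" "y \<in> topspace Y" for n a y
    by (induction n) (use that in \<open>auto simp: P0 PS comm1 P_into\<close>)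
  define \<Phi> where "\<Phi> t y = \<Psi> (frac t) (P (nat \<lfloor>t\<rfloor>) y)" for t y
  have \<Phi>: "\<Phi> (real n + a) y = \<Psi> a (P n y)" if "0 \<le> a" "a \<le> 1" "y \<in> topspace Y" for n a y
  proof (cases "a = 1")
    case True
    have "real n + a = of_int (int (Suc n))" using True by simp
    then have "nat \<lfloor>real n + a\<rfloor> = Suc n" "frac (real n + a) = 0"
      by (simp_all only: floor_of_int frac_of_int nat_int)
    then have "\<Phi> (real n + a) y = \<Psi> 0 (P (Suc n) y)" by (simp only: \<Phi>_def)
    also have "\<dots> = P (Suc n) y" using that(3) by (intro zero P_into)
    finally show ?thesis using True by (simp only: PS)
  next
    case False
    then have "\<lfloor>real n + a\<rfloor> = int n" using that by (intro floor_unique) auto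
    then show ?thesis by (simp add: \<Phi>_def frac_def)
  qed
  have split: "\<exists>n a. t = real n + a \<and> 0 \<le> a \<and> a < 1" if "0 \<le> t" for t :: real
    using that frac_lt_1[of t] by (intro exI[of _ "nat \<lfloor>t\<rfloor>"] exI[of _ "frac t"])
      (auto simp: frac_def)
  have \<Phi>_into: "\<Phi> t y \<in> topspace Y" if t: "0 \<le> t" and y: "y \<in> topspace Y" for t y
  proof -
    obtain n a where "t = real n + a" "0 \<le> a" "a < 1" using split[OF t] by blast
    then show ?thesis using y by (simp add: \<Phi> into P_into)
  qed
  have \<Phi>_add: "\<Phi> (t + s) y = \<Phi> t (\<Phi> s y)" if ts: "0 \<le> t" "0 \<le> s" and y: "y \<in> topspace Y" for t s y
  proof -
    obtain n a where a: "t = real n + a" "0 \<le> a" "a < 1" using split[OF ts(1)] by blast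
    obtain m b where b: "s = real m + b" "0 \<le> b" "b < 1" using split[OF ts(2)] by blast
    let ?z = "P (n + m) y"
    have z: "?z \<in> topspace Y" using y by (rule P_into)
    have "\<Phi> t (\<Phi> s y) = \<Psi> a (P n (\<Psi> b (P m y)))"
      using a b y by (simp add: \<Phi> P_into into)
    also have "\<dots> = \<Psi> a (\<Psi> b ?z)" using b y by (simp add: comm P_into PP)
    also have "\<dots> = \<Phi> (t + s) y"
    proof (cases "a + b \<le> 1")
      case True
      then have "\<Psi> a (\<Psi> b ?z) = \<Psi> (a + b) ?z" using a b z add by simp
      also have "\<dots> = \<Phi> (real (n + m) + (a + b)) y" using True a b y by (subst \<Phi>) auto
      finally show ?thesis using a b by (simp add: algebra_simps)
    next
      case False
      \<comment> \<open>Split \<open>a = (a + b - 1) + (1 - b)\<close>, so that \<open>1 - b\<close> and \<open>b\<close> complete a full time unit.\<close>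
      have "\<Psi> a (\<Psi> b ?z) = \<Psi> (a + b - 1) (\<Psi> (1 - b) (\<Psi> b ?z))"
        using add[of "1 - b" "a + b - 1" "\<Psi> b ?z"] False a b z into by simp
      also have "\<Psi> (1 - b) (\<Psi> b ?z) = P (Suc (n + m)) y"
        using add[of b "1 - b" ?z] b z by (simp add: PS)
      also have "\<Psi> (a + b - 1) \<dots> = \<Phi> (real (Suc (n + m)) + (a + b - 1)) y"
        using False a b y by (subst \<Phi>) auto
      finally show ?thesis using a b by (simp add: algebra_simps)
    qed
    finally show ?thesis by simp
  qed
  have contP: "continuous_map Y Y (P n)" for n
  proof (induction n)
    case 0
    then show ?case by (rule continuous_map_eq[OF continuous_map_id]) (simp add: P0)
  next
    case (Suc n)
    have "continuous_map Y (prod_topology (top_of_set {0..1}) Y) (\<lambda>y. (1::real, P n y))"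
      using Suc by (intro continuous_map_pairedI) (auto simp: eta_contract_eq)
    from continuous_map_comp[OF this cont] show ?case by (simp add: PS[abs_def])
  qed
  have fstsnd: "continuous_map (subtopology (nonneg_times Y) A) euclideanreal fst"
    "continuous_map (subtopology (nonneg_times Y) A) Y snd" for A
    by (intro continuous_map_from_subtopology continuous_map_fst_real continuous_map_snd)+
  have piece: "continuous_map (subtopology (nonneg_times Y) ({real n..real n + 1} \<times> topspace Y)) Y (\<lambda>(t, y). \<Phi> t y)" for n
  proof (rule continuous_map_eq)
    let ?Z = "subtopology (nonneg_times Y) ({real n..real n + 1} \<times> topspace Y)"
    have "continuous_map ?Z (prod_topology (top_of_set {0..1}) Y) (\<lambda>p. (fst p - real n, P n (snd p)))"
      by (intro continuous_map_pairedI continuous_map_into_subtopology continuous_map_diff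
          fstsnd continuous_map_comp[OF fstsnd(2) contP]) auto
    from continuous_map_comp[OF this cont]
    show "continuous_map ?Z Y (\<lambda>p. \<Psi> (fst p - real n) (P n (snd p)))" by simp
    show "\<Psi> (fst p - real n) (P n (snd p)) = (case p of (t, y) \<Rightarrow> \<Phi> t y)" if "p \<in> topspace ?Z" for p
      using that \<Phi>[of "fst p - real n" "snd p" n] by (auto simp: split_beta)
  qed
  have initial: "continuous_map (subtopology (nonneg_times Y) ({0..real n} \<times> topspace Y)) Y (\<lambda>(t, y). \<Phi> t y)" for n
  proof (induction n)
    case 0
    show ?case by (rule continuous_map_from_subtopology_mono[OF piece[of 0]]) auto
  next
    case (Suc n)
    let ?Z = "subtopology (nonneg_times Y) ({0..real (Suc n)} \<times> topspace Y)"
    show ?case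
    proof (rule continuous_map_two_closed)
      show "closedin ?Z {p \<in> topspace ?Z. fst p \<le> real n}" "closedin ?Z {p \<in> topspace ?Z. real n \<le> fst p}"
        by (intro closedin_real_le fstsnd; simp)+
      show "topspace ?Z \<subseteq> {p \<in> topspace ?Z. fst p \<le> real n} \<union> {p \<in> topspace ?Z. real n \<le> fst p}"
        by auto
      show "continuous_map (subtopology ?Z {p \<in> topspace ?Z. fst p \<le> real n}) Y (\<lambda>(t, y). \<Phi> t y)"
        unfolding subtopology_subtopology
        by (rule continuous_map_from_subtopology_mono[OF Suc]) auto
      show "continuous_map (subtopology ?Z {p \<in> topspace ?Z. real n \<le> fst p}) Y (\<lambda>(t, y). \<Phi> t y)"
        unfolding subtopology_subtopology
        by (rule continuous_map_from_subtopology_mono[OF piece[of n]]) auto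
    qed
  qed
  have cont\<Phi>: "continuous_map (nonneg_times Y) Y (\<lambda>(t, y). \<Phi> t y)"
  proof (rule continuous_map_locally)
    fix p assume p: "p \<in> topspace (nonneg_times Y)"
    obtain n where n: "fst p < real n" using reals_Archimedean2 by blast
    let ?V = "{p \<in> topspace (nonneg_times Y). fst p < real n}"
    have "openin (nonneg_times Y) ?V"
      by (intro openin_real_greater continuous_map_fst_real) simp
    moreover have "continuous_map (subtopology (nonneg_times Y) ?V) Y (\<lambda>(t, y). \<Phi> t y)"
      by (rule continuous_map_from_subtopology_mono[OF initial[of n]]) auto
    ultimately show "\<exists>V. openin (nonneg_times Y) V \<and> p \<in> V \<and>
        continuous_map (subtopology (nonneg_times Y) V) Y (\<lambda>(t, y). \<Phi> t y)"
      using n p by (intro exI[of _ ?V]) auto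
  qed
  have eq: "\<Phi> t y = \<Psi> t y" if "0 \<le> t" "t \<le> 1" "y \<in> topspace Y" for t y
    using \<Phi>[of t y 0] that by (simp add: P0)
  have full: "{0..} \<times> topspace Y = topspace (nonneg_times Y)" by simp
  have "openin (nonneg_times Y) ({0..} \<times> topspace Y)"
    unfolding full by (rule openin_topspace)
  moreover have "subtopology (nonneg_times Y) ({0..} \<times> topspace Y) = nonneg_times Y"
    unfolding full by (rule subtopology_topspace)
  ultimately have "continuous_semiflow Y \<Phi>"
    using cont\<Phi> \<Phi>_into \<Phi>_add zero eq[of 0]
    by (simp add: continuous_semiflow_def continuous_local_semiflow_def local_semiflow_def Sigma_mono)
  then show thesis using eq by (rule that)
qed

section \<open>The suspension as a single quotient\<close>

lemma generated_equiv_respects: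
  assumes "(a, b) \<in> generated_equiv A R" "\<And>x y. (x, y) \<in> R \<Longrightarrow> f x = f y"
  shows "f a = f b"
proof -
  from assms(1) have "(a, b) \<in> (R \<union> R\<inverse>)\<^sup>*" by (simp add: generated_equiv_def)
  then show ?thesis by induction (use assms(2) in fastforce)+
qed

lemma proj_generated_equiv_eq_iff:
  assumes "a \<in> A" "b \<in> A"
  shows "Equiv_Relations.proj (generated_equiv A R) a = Equiv_Relations.proj (generated_equiv A R) b
    \<longleftrightarrow> (a, b) \<in> generated_equiv A R"
  using eq_equiv_class_iff[OF equiv_generated_equiv assms] by (simp add: Equiv_Relations.proj_def)

locale hybrid =
  fixes H :: "'a hybrid_system"
  assumes ths: "topological_hybrid_system H"
begin

abbreviation X where "X \<equiv> state_space H"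
abbreviation F where "F \<equiv> flow_set H"
abbreviation G where "G \<equiv> guard H"
abbreviation D where "D \<equiv> flow_dom H"
abbreviation \<phi> where "\<phi> \<equiv> flow H"
abbreviation r where "r \<equiv> reset H"
abbreviation \<Sigma> where "\<Sigma> \<equiv> suspension H"
abbreviation cylinder where
  "cylinder \<equiv> prod_topology (subtopology X G) (top_of_set {0..1::real})"

text \<open>The composite of the two gluing quotient maps; \<open>q \<circ> Inl\<close> is the map from the state space to the
  suspension.\<close>
definition q :: "'a + 'a \<times> real \<Rightarrow> ('a + 'a \<times> real) set set" where
  "q = pi_susp H \<circ> pi0 H"

lemma guard_subset: "G \<subseteq> topspace X"
  using ths by (auto simp: topological_hybrid_system_def dest: closedin_subset)

lemma continuous_reset: "continuous_map (subtopology X G) X r"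
  using ths by (simp add: topological_hybrid_system_def)

lemma reset_in: "z \<in> G \<Longrightarrow> r z \<in> topspace X"
  using continuous_map_image_subset_topspace[OF continuous_reset] guard_subset
  by (auto simp: topspace_subtopology)

lemma cylinder_sum_eq: "cylinder_sum H = disjoint_union_topology X cylinder"
  by (simp add: cylinder_sum_def)

lemma topspace_cylinder_sum: "topspace (cylinder_sum H) = topspace X <+> G \<times> {0..1}"
  using guard_subset by (auto simp: cylinder_sum_def)

lemma quotient_map_q: "quotient_map (cylinder_sum H) \<Sigma> q"
  unfolding q_def pi_susp_def pi0_def suspension_def
  by (rule quotient_map_compose[OF quotient_map_proj[of "cylinder_sum H"]])
     (simp add: collared_space_def quotient_map_proj)

lemma pi0_in: "a \<in> topspace (cylinder_sum H) \<Longrightarrow> pi0 H a \<in> topspace (collared_space H)"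
  by (simp add: pi0_def collared_space_def Equiv_Relations.proj_def quotientI)

lemma q_bottom: "z \<in> G \<Longrightarrow> q (Inr (z, 0)) = q (Inl z)"
proof -
  assume z: "z \<in> G"
  have "(Inl z, Inr (z, 0)) \<in> collar_equiv H"
    unfolding collar_equiv_def
    by (rule subsetD[OF generated_equiv_contains]) (use z guard_subset topspace_cylinder_sum in auto)
  then have "pi0 H (Inl z) = pi0 H (Inr (z, 0))"
    unfolding pi0_def collar_equiv_def using z guard_subset
    by (subst proj_generated_equiv_eq_iff) (auto simp: topspace_cylinder_sum)
  then show ?thesis by (simp add: q_def)
qed

lemma q_top: "z \<in> G \<Longrightarrow> q (Inr (z, 1)) = q (Inl (r z))"
proof -
  assume z: "z \<in> G"
  have in1: "pi0 H (Inr (w, 1)) \<in> topspace (collared_space H)"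
    and in2: "pi0 H (Inl (r w)) \<in> topspace (collared_space H)" if "w \<in> G" for w
    using that by (auto intro!: pi0_in simp: topspace_cylinder_sum reset_in)
  have "(pi0 H (Inr (z, 1)), pi0 H (Inl (r z))) \<in> suspension_equiv H"
    unfolding suspension_equiv_def
    by (rule subsetD[OF generated_equiv_contains]) (use z in1 in2 in auto)
  then show ?thesis
    unfolding q_def pi_susp_def suspension_equiv_def o_def
    by (subst proj_generated_equiv_eq_iff) (use z in1 in2 in auto)
qed

text \<open>The two generated equivalence relations are never computed: a function respecting the gluings
  descends through the first quotient, hence through the second. Taking \<open>f\<close> to be the indicator of
  a set also shows that the set is saturated.\<close>
lemma q_eqD:
  assumes "q a = q b" "a \<in> topspace (cylinder_sum H)" "b \<in> topspace (cylinder_sum H)"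
    and bot: "\<And>z. z \<in> G \<Longrightarrow> f (Inr (z, 0)) = f (Inl z)"
    and top: "\<And>z. z \<in> G \<Longrightarrow> f (Inr (z, 1)) = f (Inl (r z))"
  shows "f a = f b"
proof -
  have collar: "f c = f d" if "c \<in> topspace (cylinder_sum H)" "d \<in> topspace (cylinder_sum H)"
    "pi0 H c = pi0 H d" for c d
  proof (rule generated_equiv_respects[where f = f])
    show "(c, d) \<in> generated_equiv (topspace (cylinder_sum H)) {(Inl z, Inr (z, 0)) |z. z \<in> G}"
      using that unfolding pi0_def collar_equiv_def by (subst (asm) proj_generated_equiv_eq_iff) auto
  qed (use bot in auto)
  \<comment> \<open>The function induced by \<open>f\<close> on the first quotient.\<close>
  define f' where "f' c = f (SOME a. a \<in> topspace (cylinder_sum H) \<and> pi0 H a = c)" for c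
  have f': "f' (pi0 H c) = f c" if c: "c \<in> topspace (cylinder_sum H)" for c
  proof -
    have "\<exists>d. d \<in> topspace (cylinder_sum H) \<and> pi0 H d = pi0 H c" using c by blast
    from someI_ex[OF this] show ?thesis unfolding f'_def by (intro collar) (use c in auto)
  qed
  have "f' (pi0 H a) = f' (pi0 H b)"
  proof (rule generated_equiv_respects[where f = f'])
    show "(pi0 H a, pi0 H b) \<in> generated_equiv (topspace (collared_space H))
       {(pi0 H (Inr (z, 1)), pi0 H (Inl (r z))) | z. z \<in> G}"
      using assms(1) pi0_in[OF assms(2)] pi0_in[OF assms(3)]
      unfolding q_def pi_susp_def suspension_equiv_def o_def
      by (subst (asm) proj_generated_equiv_eq_iff) auto
  next
    fix x y assume "(x, y) \<in> {(pi0 H (Inr (z, 1)), pi0 H (Inl (r z))) |z. z \<in> G}"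
    then obtain z where z: "z \<in> G" "x = pi0 H (Inr (z, 1))" "y = pi0 H (Inl (r z))" by auto
    then have "f' x = f (Inr (z, 1))" "f' y = f (Inl (r z))"
      by (auto intro!: f' simp: topspace_cylinder_sum reset_in)
    then show "f' x = f' y" using top z(1) by simp
  qed
  then show ?thesis using f' assms(2,3) by simp
qed

text \<open>The universal property of the quotient, localised to open saturated sets. Saturation and
  constancy on fibres are obtained together, by viewing \<open>f\<close> as a partial function with domain \<open>A\<close>.\<close>
lemma open_saturated_lift:
  assumes A: "openin (cylinder_sum H) A"
    and A0: "\<And>z. z \<in> G \<Longrightarrow> Inr (z, 0) \<in> A \<longleftrightarrow> Inl z \<in> A"
    and A1: "\<And>z. z \<in> G \<Longrightarrow> Inr (z, 1) \<in> A \<longleftrightarrow> Inl (r z) \<in> A"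
    and f: "continuous_map (subtopology (cylinder_sum H) A) Y f"
    and f0: "\<And>z. z \<in> G \<Longrightarrow> Inl z \<in> A \<Longrightarrow> f (Inr (z, 0)) = f (Inl z)"
    and f1: "\<And>z. z \<in> G \<Longrightarrow> Inl (r z) \<in> A \<Longrightarrow> f (Inr (z, 1)) = f (Inl (r z))"
  obtains g where "openin \<Sigma> (q ` A)" "continuous_map (subtopology \<Sigma> (q ` A)) Y g"
    "\<And>a. a \<in> A \<Longrightarrow> g (q a) = f a"
    "\<And>a. a \<in> topspace (cylinder_sum H) \<Longrightarrow> q a \<in> q ` A \<longleftrightarrow> a \<in> A"
proof -
  have AS: "A \<subseteq> topspace (cylinder_sum H)" using A openin_subset by blast
  \<comment> \<open>The fibres of \<open>q\<close> cannot distinguish membership in \<open>A\<close> nor values of \<open>f\<close>.\<close>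
  define f' where "f' a = (if a \<in> A then Some (f a) else None)" for a
  have fib: "f' a = f' b" if "q a = q b" "a \<in> topspace (cylinder_sum H)" "b \<in> topspace (cylinder_sum H)" for a b
    by (rule q_eqD[OF that]) (auto simp: f'_def A0 A1 f0 f1)
  have sat: "q a \<in> q ` A \<longleftrightarrow> a \<in> A" if a: "a \<in> topspace (cylinder_sum H)" for a
  proof
    assume "q a \<in> q ` A"
    then obtain b where "b \<in> A" "q a = q b" by auto
    then show "a \<in> A" using fib[of a b] a AS by (auto simp: f'_def split: if_splits)
  qed simp
  have qA: "{a \<in> topspace (cylinder_sum H). q a \<in> q ` A} = A"
    using sat AS by auto
  then have op: "openin \<Sigma> (q ` A)"
    using quotient_map_q A unfolding quotient_map_saturated_open by auto
  have quot: "quotient_map (subtopology (cylinder_sum H) A) (subtopology \<Sigma> (q ` A)) q"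
    by (rule quotient_map_restriction[OF quotient_map_q qA]) (simp add: op)
  have fibA: "f a = f b" if "a \<in> A" "b \<in> A" "q a = q b" for a b
    using fib[of a b] that AS by (auto simp: f'_def)
  obtain g where "continuous_map (subtopology \<Sigma> (q ` A)) Y g"
    "\<And>a. a \<in> topspace (subtopology (cylinder_sum H) A) \<Longrightarrow> g (q a) = f a"
    by (rule quotient_map_lift_exists[OF quot f]) (use fibA in auto)
  then show thesis
    using that[of g] op sat AS by auto
qed

lemma continuous_q_Inl: "continuous_map X \<Sigma> (\<lambda>x. q (Inl x))"
  by (rule continuous_map_comp[OF _ quotient_imp_continuous_map[OF quotient_map_q]])
     (simp add: cylinder_sum_eq continuous_map_Inl)

lemma continuous_q_Inr: "continuous_map cylinder \<Sigma> (\<lambda>p. q (Inr p))"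
  by (rule continuous_map_comp[OF _ quotient_imp_continuous_map[OF quotient_map_q]])
     (simp add: cylinder_sum_eq continuous_map_Inr)

text \<open>Removing the middle of the cylinder leaves a neighbourhood of the image of \<open>X\<close> that can be
  collapsed onto it along the cylinder, downwards below the middle and upwards, with a reset, above it.
  Hence \<open>X\<close> embeds in the suspension, and limits of curves that stay in the image of \<open>X\<close> can be computed
  in \<open>X\<close>.\<close>
lemma state_space_neighbourhood_retract:
  obtains N g where "openin \<Sigma> N" "continuous_map (subtopology \<Sigma> N) X g"
    "\<And>x. x \<in> topspace X \<Longrightarrow> q (Inl x) \<in> N \<and> g (q (Inl x)) = x"
proof -
  \<comment> \<open>At height \<open>1/2\<close> the formulas \<open>z\<close> and \<open>r z\<close> would disagree.\<close>
  define A where "A = Inl ` topspace X \<union> Inr ` {p \<in> topspace cylinder. snd p \<noteq> (1/2::real)}"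
  define f where "f a = (case a of Inl x \<Rightarrow> x | Inr p \<Rightarrow> if snd p < 1/2 then fst p else r (fst p))"
    for a :: "'a + 'a \<times> real"
  have snd: "continuous_map cylinder euclideanreal snd"
    using continuous_map_snd continuous_map_into_fulltopology by blast
  define lo where "lo = {p \<in> topspace cylinder. snd p < 1/2}"
  define hi where "hi = {p \<in> topspace cylinder. 1/2 < snd p}"
  have lo: "openin cylinder lo" and hi: "openin cylinder hi"
    unfolding lo_def hi_def by (intro openin_real_greater snd; simp)+
  have openI: "openin (cylinder_sum H) (Inr ` V)" if "openin cylinder V" for V
    using that by (simp add: cylinder_sum_eq openin_Inr_image)
  have Aeq: "A = Inl ` topspace X \<union> (Inr ` lo \<union> Inr ` hi)"
    by (force simp: A_def lo_def hi_def)
  have opL: "openin (cylinder_sum H) (Inl ` topspace X)"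
    by (simp add: cylinder_sum_eq openin_Inl_image)
  have A: "openin (cylinder_sum H) A"
    unfolding Aeq by (intro openin_Un opL openI lo hi)
  have cr: "continuous_map (subtopology (cylinder_sum H) (Inr ` V)) cylinder projr"
    if "V \<subseteq> topspace cylinder" for V
    by (rule continuous_map_from_subtopology_mono[OF _ image_mono[OF that]])
       (simp only: cylinder_sum_eq continuous_map_projr)
  have f: "continuous_map (subtopology (cylinder_sum H) A) X f"
  proof (rule continuous_map_locally)
    let ?A = "subtopology (cylinder_sum H) A"
    have pasted: "openin ?A V \<and> continuous_map (subtopology ?A V) X f"
      if "openin (cylinder_sum H) V" "V \<subseteq> A" "continuous_map (subtopology (cylinder_sum H) V) X f" for V
      using that by (simp add: subtopology_subtopology Int_absorb1 openin_open_subtopology A)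
    have 1: "continuous_map (subtopology (cylinder_sum H) (Inl ` topspace X)) X f"
      by (rule continuous_map_eq[where f = projl])
         (auto simp: cylinder_sum_eq f_def intro!: continuous_map_projl)
    have 2: "continuous_map (subtopology (cylinder_sum H) (Inr ` lo)) X f"
    proof (rule continuous_map_eq[where f = "\<lambda>a. fst (projr a)"])
      show "continuous_map (subtopology (cylinder_sum H) (Inr ` lo)) X (\<lambda>a. fst (projr a))"
        by (rule continuous_map_comp[OF cr continuous_map_into_fulltopology[OF continuous_map_fst]])
           (auto simp: lo_def)
    qed (auto simp: f_def lo_def)
    have 3: "continuous_map (subtopology (cylinder_sum H) (Inr ` hi)) X f"
    proof (rule continuous_map_eq[where f = "\<lambda>a. r (fst (projr a))"])
      show "continuous_map (subtopology (cylinder_sum H) (Inr ` hi)) X (\<lambda>a. r (fst (projr a)))"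
        by (rule continuous_map_comp[OF cr continuous_map_comp[OF continuous_map_fst continuous_reset]])
           (auto simp: hi_def)
    qed (auto simp: f_def hi_def)
    fix z assume "z \<in> topspace ?A"
    then have "z \<in> Inl ` topspace X \<or> z \<in> Inr ` lo \<or> z \<in> Inr ` hi" by (auto simp: Aeq)
    moreover have "Inl ` topspace X \<subseteq> A" "Inr ` lo \<subseteq> A" "Inr ` hi \<subseteq> A" by (auto simp: Aeq)
    ultimately show "\<exists>V. openin ?A V \<and> z \<in> V \<and> continuous_map (subtopology ?A V) X f"
      using pasted[OF opL _ 1] pasted[OF openI[OF lo] _ 2] pasted[OF openI[OF hi] _ 3] by metis
  qed
  obtain g where "openin \<Sigma> (q ` A)" "continuous_map (subtopology \<Sigma> (q ` A)) X g"
    "\<And>a. a \<in> A \<Longrightarrow> g (q a) = f a"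
  proof (rule open_saturated_lift[OF A _ _ f])
    show "(Inr (z, 0) \<in> A) = (Inl z \<in> A)" if "z \<in> G" for z
      using that guard_subset by (auto simp: A_def)
    show "(Inr (z, 1) \<in> A) = (Inl (r z) \<in> A)" if "z \<in> G" for z
      using that guard_subset reset_in[OF that] by (auto simp: A_def)
  qed (auto simp: f_def)
  then show thesis
    by (intro that[of "q ` A" g]) (auto simp: A_def f_def)
qed

definition open_cylinder :: "('a + 'a \<times> real) set set set" where
  "open_cylinder = (\<lambda>p. q (Inr p)) ` (G \<times> {0<..<1})"

text \<open>No point of the open cylinder is glued to another one, so the projection of the cylinder onto
  itself descends to a chart. The last clause makes the image of \<open>X\<close> closed.\<close>
lemma open_cylinder_chart:
  obtains k where "openin \<Sigma> open_cylinder" "continuous_map (subtopology \<Sigma> open_cylinder) cylinder k"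
    "\<And>z s. z \<in> G \<Longrightarrow> 0 < s \<Longrightarrow> s < 1 \<Longrightarrow> k (q (Inr (z, s))) = (z, s)"
    "\<And>x. x \<in> topspace X \<Longrightarrow> q (Inl x) \<notin> open_cylinder"
proof -
  define A where "A = (Inr ` (G \<times> {0<..<1}) :: ('a + 'a \<times> real) set)"
  have op: "openin cylinder (G \<times> {0<..<1})"
  proof -
    have "openin (subtopology X G) G"
      using openin_topspace[of "subtopology X G"] guard_subset by (simp add: Int_absorb1)
    moreover have "openin (top_of_set {0..1::real}) {0<..<1}"
      by (rule openin_subset_trans[of UNIV]) (auto simp: openin_open)
    ultimately show ?thesis by (simp add: openin_prod_Times_iff)
  qed
  have A: "openin (cylinder_sum H) A"
    unfolding A_def using op by (simp add: cylinder_sum_eq openin_Inr_image)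
  have cr: "continuous_map (subtopology (cylinder_sum H) A) cylinder projr"
    unfolding A_def
    by (rule continuous_map_from_subtopology_mono[OF _ image_mono[OF openin_subset[OF op]]])
       (simp only: cylinder_sum_eq continuous_map_projr)
  obtain k where k: "openin \<Sigma> (q ` A)" "continuous_map (subtopology \<Sigma> (q ` A)) cylinder k"
    "\<And>a. a \<in> A \<Longrightarrow> k (q a) = projr a"
    "\<And>a. a \<in> topspace (cylinder_sum H) \<Longrightarrow> q a \<in> q ` A \<longleftrightarrow> a \<in> A"
    by (rule open_saturated_lift[OF A _ _ cr]) (auto simp: A_def)
  have "q ` A = open_cylinder" by (simp add: A_def open_cylinder_def image_image)
  moreover have "q (Inl x) \<notin> q ` A" if "x \<in> topspace X" for x
    using k(4)[of "Inl x"] that by (auto simp: A_def topspace_cylinder_sum)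
  ultimately show thesis
    using k(1,2,3) by (intro that[of k]) (auto simp: A_def)
qed

lemma suspension_point_cases:
  assumes "y \<in> topspace \<Sigma>"
  obtains (state) x where "x \<in> topspace X" "y = q (Inl x)"
    | (cylinder) z s where "z \<in> G" "0 \<le> s" "s \<le> 1" "y = q (Inr (z, s))"
proof -
  obtain a where a: "a \<in> topspace (cylinder_sum H)" "y = q a"
    using assms quotient_imp_surjective_map[OF quotient_map_q] by blast
  from a(1)[unfolded topspace_cylinder_sum] show thesis
  proof (rule PlusE)
    fix x assume "x \<in> topspace X" "a = Inl x"
    then show thesis using state a(2) by blast
  next
    fix p assume "p \<in> G \<times> {0..1::real}" "a = Inr p"
    then show thesis using cylinder[of "fst p" "snd p"] a(2) by (cases p) simp
  qed
qed

lemma suspension_cases: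
  assumes "y \<in> topspace \<Sigma>"
  obtains x where "x \<in> topspace X" "y = q (Inl x)" | "y \<in> open_cylinder"
  using assms
proof (cases rule: suspension_point_cases)
  case (state x)
  then show thesis by (rule that(1))
next
  case (cylinder z s)
  then consider "s = 0" | "s = 1" | "0 < s" "s < 1" by linarith
  then show thesis
    using cylinder that(1)[of z] that(1)[of "r z"] that(2) guard_subset
    by cases (auto simp: q_bottom q_top reset_in open_cylinder_def)
qed

end

section \<open>Orbits and their end points in the guard\<close>

text \<open>Maximum flow times are compared through the times at which the flow is still defined.\<close>
lemma ereal_eq_if_same_lower_cut:
  fixes a b :: ereal
  assumes "0 \<le> a" "0 \<le> b" "\<And>t. 0 \<le> t \<Longrightarrow> ereal t < a \<longleftrightarrow> ereal t < b"
  shows "a = b"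
proof -
  have False if c: "0 \<le> c" "c < d" and cut: "\<And>t. 0 \<le> t \<Longrightarrow> ereal t < c \<longleftrightarrow> ereal t < d"
    for c d :: ereal
  proof -
    obtain t where t: "c < ereal t" "ereal t < d" using ereal_dense2[OF c(2)] by blast
    have "0 < ereal t" using c(1) t(1) by (rule order_le_less_trans)
    then have "0 \<le> t" by simp
    then show False using cut[of t] t by simp
  qed
  from this[of a b] this[of b a] show ?thesis using assms by (metis linorder_neqE)
qed

context hybrid
begin

lemma flow_set_subset: "F \<subseteq> topspace X"
  using ths by (auto simp: topological_hybrid_system_def dest: openin_subset)

lemma topspace_flow_set: "topspace (subtopology X F) = F"
  using flow_set_subset by auto

lemma local_semiflow: "local_semiflow (subtopology X F) D \<phi>"
  using ths by (simp add: topological_hybrid_system_def continuous_local_semiflow_def)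

lemma openin_flow_dom_flow_set: "openin (nonneg_times (subtopology X F)) D"
  using local_semiflow by (simp add: local_semiflow_def)

lemma openin_flow_dom: "openin (nonneg_times X) D"
proof (rule openin_trans_full[OF openin_flow_dom_flow_set[unfolded prod_topology_subtopology(2)]])
  show "openin (nonneg_times X) (topspace (top_of_set {0..}) \<times> F)"
    using ths by (simp add: openin_prod_Times_iff topological_hybrid_system_def del: topspace_euclidean_subtopology)
qed

lemma flow_domD: "(t, x) \<in> D \<Longrightarrow> 0 \<le> t \<and> x \<in> F"
  using openin_subset[OF openin_flow_dom_flow_set] by auto

lemma zero_in_flow_dom: "x \<in> F \<Longrightarrow> (0, x) \<in> D"
  using local_semiflow topspace_flow_set unfolding local_semiflow_def by blast

lemma flow_in: "(t, x) \<in> D \<Longrightarrow> \<phi> t x \<in> F"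
  using local_semiflow topspace_flow_set unfolding local_semiflow_def by blast

lemma flow_zero: "x \<in> F \<Longrightarrow> \<phi> 0 x = x"
  using local_semiflow topspace_flow_set unfolding local_semiflow_def by blast

lemma flow_dom_add:
  "0 \<le> t \<Longrightarrow> 0 \<le> s \<Longrightarrow> x \<in> F \<Longrightarrow> (t + s, x) \<in> D \<longleftrightarrow> (s, x) \<in> D \<and> (t, \<phi> s x) \<in> D"
  using local_semiflow topspace_flow_set unfolding local_semiflow_def by blast

lemma flow_add: "0 \<le> t \<Longrightarrow> 0 \<le> s \<Longrightarrow> (t + s, x) \<in> D \<Longrightarrow> \<phi> (t + s) x = \<phi> t (\<phi> s x)"
  using local_semiflow unfolding local_semiflow_def by blast

lemma continuous_flow: "continuous_map (subtopology (nonneg_times X) D) X (\<lambda>(t, x). \<phi> t x)"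
proof -
  have "subtopology (nonneg_times (subtopology X F)) D = subtopology (nonneg_times X) D"
    using openin_subset[OF openin_flow_dom_flow_set]
    by (simp add: prod_topology_subtopology subtopology_subtopology Int_absorb1)
  moreover have "continuous_map (subtopology (nonneg_times (subtopology X F)) D) X (\<lambda>(t, x). \<phi> t x)"
    using ths by (auto simp: topological_hybrid_system_def continuous_local_semiflow_def
        continuous_map_in_subtopology)
  ultimately show ?thesis by simp
qed

text \<open>This form of continuity of \<open>\<phi>\<close> applies to any pair of time and initial point that depends
  continuously on a parameter.\<close>
lemma continuous_flow_comp:
  assumes "continuous_map Z euclideanreal f" "continuous_map Z X g"
    and "\<And>z. z \<in> topspace Z \<Longrightarrow> (f z, g z) \<in> D"
  shows "continuous_map Z X (\<lambda>z. \<phi> (f z) (g z))"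
proof -
  have "f \<in> topspace Z \<rightarrow> {0..}" using assms(3) flow_domD by fastforce
  then have "continuous_map Z (subtopology (nonneg_times X) D) (\<lambda>z. (f z, g z))"
    using assms by (auto simp: continuous_map_in_subtopology continuous_map_paired)
  from continuous_map_comp[OF this continuous_flow] show ?thesis by simp
qed

abbreviation \<mu> where "\<mu> \<equiv> max_flow_time H"

text \<open>Only meaningful where \<open>\<mu> x\<close> is finite.\<close>
definition hit_time where "hit_time x = real_of_ereal (\<mu> x)"

lemma flow_dom_open_ended:
  assumes "(t, x) \<in> D" obtains t' where "t < t'" "(t', x) \<in> D"
proof -
  have "x \<in> topspace X" using flow_domD[OF assms] flow_set_subset by auto
  then have "continuous_map (top_of_set {0..}) (nonneg_times X) (\<lambda>u. (u, x))"
    by (intro continuous_map_pairedI) auto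
  from openin_continuous_map_preimage[OF this openin_flow_dom]
  have "openin (top_of_set {0..}) {u \<in> {0..}. (u, x) \<in> D}" by simp
  moreover have "t \<in> {u \<in> {0..}. (u, x) \<in> D}" using assms flow_domD by auto
  ultimately obtain e where "0 < e"
    "\<And>u. u \<in> {0..} \<Longrightarrow> dist u t < e \<Longrightarrow> u \<in> {u \<in> {0..}. (u, x) \<in> D}"
    unfolding openin_euclidean_subtopology_iff by blast
  from this(2)[of "t + e / 2"] this(1) show thesis
    using flow_domD[OF assms] by (intro that[of "t + e/2"]) (auto simp: dist_real_def)
qed

text \<open>The time domain of an orbit is an initial segment by the semiflow law and has no last element by
  openness of the flow domain.\<close>
lemma flow_dom_iff:
  assumes "x \<in> topspace X" shows "(t, x) \<in> D \<longleftrightarrow> 0 \<le> t \<and> ereal t < \<mu> x"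
proof (cases "x \<in> F")
  case False
  then show ?thesis using flow_domD by (auto simp: max_flow_time_def)
next
  case True
  define A where "A = {ereal t | t. t \<ge> 0 \<and> (t, x) \<in> D}"
  have mu: "\<mu> x = Sup A" using True by (simp add: max_flow_time_def A_def)
  show ?thesis
  proof
    assume t: "(t, x) \<in> D"
    then obtain t' where t': "t < t'" "(t', x) \<in> D" by (rule flow_dom_open_ended)
    then have "ereal t' \<in> A" using flow_domD by (auto simp: A_def)
    then have "ereal t' \<le> \<mu> x" unfolding mu by (rule Sup_upper)
    with t' have "ereal t < \<mu> x" by (meson less_ereal.simps(1) less_le_trans)
    then show "0 \<le> t \<and> ereal t < \<mu> x" using t flow_domD by auto
  next
    assume t: "0 \<le> t \<and> ereal t < \<mu> x"
    then obtain t' where "t < t'" "(t', x) \<in> D"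
      unfolding mu less_Sup_iff A_def by auto
    then show "(t, x) \<in> D" using flow_dom_add[of "t' - t" t x] t True by auto
  qed
qed

lemma max_flow_time_nonneg: "0 \<le> \<mu> x"
proof (cases "x \<in> F")
  case True
  then have "ereal 0 \<in> {ereal t | t. t \<ge> 0 \<and> (t, x) \<in> D}" using zero_in_flow_dom by auto
  then show ?thesis using True by (auto simp: max_flow_time_def zero_ereal_def intro: Sup_upper)
qed (simp add: max_flow_time_def)

lemma less_max_flow_time_iff: "\<mu> x \<noteq> \<infinity> \<Longrightarrow> ereal t < \<mu> x \<longleftrightarrow> t < hit_time x"
  using max_flow_time_nonneg[of x] unfolding hit_time_def by (cases "\<mu> x") auto

lemma hit_time_nonneg: "0 \<le> hit_time x"
  using max_flow_time_nonneg[of x] unfolding hit_time_def by (simp add: real_of_ereal_pos)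

lemma max_flow_time_flow:
  assumes "(s, x) \<in> D" shows "\<mu> x = ereal s + \<mu> (\<phi> s x)"
proof (rule ereal_eq_if_same_lower_cut)
  have x: "x \<in> F" "x \<in> topspace X" and s: "0 \<le> s" using flow_domD[OF assms] flow_set_subset by auto
  have y: "\<phi> s x \<in> topspace X" using flow_in[OF assms] flow_set_subset by auto
  show "0 \<le> \<mu> x" by (rule max_flow_time_nonneg)
  show "0 \<le> ereal s + \<mu> (\<phi> s x)" using s max_flow_time_nonneg by simp
  fix t :: real assume t: "0 \<le> t"
  show "ereal t < \<mu> x \<longleftrightarrow> ereal t < ereal s + \<mu> (\<phi> s x)"
  proof (cases "s \<le> t")
    case True
    then have "ereal t < \<mu> x \<longleftrightarrow> ereal (t - s) < \<mu> (\<phi> s x)"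
      using flow_dom_add[of "t - s" s x] x y s assms flow_dom_iff t by auto
    then show ?thesis by (cases "\<mu> (\<phi> s x)") auto
  next
    case False
    have "ereal t < ereal s + 0" using False by simp
    also have "\<dots> \<le> ereal s + \<mu> (\<phi> s x)" by (intro add_left_mono max_flow_time_nonneg)
    finally have "ereal t < ereal s + \<mu> (\<phi> s x)" .
    moreover have "ereal s < \<mu> x" using assms flow_dom_iff[OF x(2)] by simp
    ultimately show ?thesis using False by (meson ereal_less_eq(3) le_less_trans linorder_linear)
  qed
qed

lemma hit_time_flow:
  assumes "(s, x) \<in> D" "\<mu> x \<noteq> \<infinity>"
  shows "\<mu> (\<phi> s x) \<noteq> \<infinity>" "hit_time (\<phi> s x) = hit_time x - s"
  using max_flow_time_flow[OF assms(1)] assms(2) max_flow_time_nonneg[of "\<phi> s x"]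
  unfolding hit_time_def by (cases "\<mu> (\<phi> s x)"; auto)+

text \<open>The limit in the guard of the orbit of \<open>x\<close> at its hitting time. On the guard itself the choice would
  be arbitrary, since the orbit is empty there, and has to be fixed to \<open>x\<close>.\<close>
definition endpoint where
  "endpoint x = (if x \<in> G then x else SOME z. z \<in> G \<and>
     continuous_map (top_of_set {0..hit_time x}) X (\<lambda>t. if ereal t < \<mu> x then \<phi> t x else z))"

definition closed_flow where
  "closed_flow t x = (if ereal t < \<mu> x then \<phi> t x else endpoint x)"

text \<open>The position at time \<open>t\<close> of the suspension orbit starting in \<open>x\<close>. The formula is the intended one as
  long as \<open>t\<close> does not exceed the hitting time by more than the height \<open>1\<close> of the cylinder.\<close>
definition advance where
  "advance t x = (if ereal t < \<mu> x then q (Inl (\<phi> t x)) else q (Inr (endpoint x, t - hit_time x)))"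

lemma endpoint_guard: "z \<in> G \<Longrightarrow> endpoint z = z"
  by (simp add: endpoint_def)

end

locale complete_hybrid = hybrid +
  assumes hausdorff: "Hausdorff_space (state_space H)"
    and det: "deterministic H"
    and execs: "\<And>x. x \<in> topspace (state_space H) \<Longrightarrow>
           \<exists>e. is_execution H e \<and> starts_at e x \<and> (infinite_execution e \<or> zeno_execution e)"
begin

lemma guard_max_flow_time: "z \<in> G \<Longrightarrow> \<mu> z = 0"
  using det by (auto simp: max_flow_time_def deterministic_def)

lemma guard_hit_time: "z \<in> G \<Longrightarrow> hit_time z = 0"
  by (simp add: hit_time_def guard_max_flow_time)

text \<open>All that is needed from executions is their first arc. Without a jump the execution must be
  infinite, so the first arc lasts forever; otherwise it ends in the guard, and it is trivial exactly
  when the execution starts there.\<close>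
lemma first_arc:
  assumes x: "x \<in> topspace X"
  obtains (guard) "x \<in> G"
  | (forever) "\<And>t. 0 \<le> t \<Longrightarrow> (t, x) \<in> D"
  | (arc) b \<gamma> where "0 < b" "\<And>t. 0 \<le> t \<Longrightarrow> t < b \<Longrightarrow> (t, x) \<in> D \<and> \<gamma> t = \<phi> t x"
      "continuous_map (top_of_set {0..b}) X \<gamma>" "\<gamma> b \<in> G"
proof -
  obtain e where e: "is_execution H e" "starts_at e x" "infinite_execution e \<or> zeno_execution e"
    using execs[OF x] by blast
  have j0: "jump_time e 0 = 0" and start: "0 \<in> traj_dom e 0" "traj e 0 0 = x"
    using e by (auto simp: is_execution_def starts_at_def)
  have "enat 0 < jumps e + 1" by (cases "jumps e") (auto simp: one_enat_def)
  then have seg: "continuous_map (top_of_set (traj_dom e 0)) X (traj e 0)"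
    "\<And>t. 0 \<le> t \<Longrightarrow> ereal t < jump_time e (Suc 0) \<Longrightarrow> (t, x) \<in> D \<and> traj e 0 t = \<phi> t x"
    "jump_time e 0 \<le> jump_time e (Suc 0)"
    using e(1) j0 start(2) unfolding is_execution_def Let_def by (auto simp: zero_ereal_def)
  show thesis
  proof (cases "jumps e = 0")
    case True
    then have "stop_time e = \<infinity>"
      using e(3) by (auto simp: infinite_execution_def zeno_execution_def)
    then have "jump_time e (Suc 0) = \<infinity>" using True by (simp add: stop_time_def zero_enat_def)
    then show thesis using seg(2) by (intro forever) auto
  next
    case False
    then have n: "enat 0 < jumps e" "enat (Suc 0) \<le> jumps e"
      by (cases "jumps e"; auto simp: zero_enat_def)+
    define b where "b = real_of_ereal (jump_time e (Suc 0))"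
    have b: "jump_time e (Suc 0) = ereal b"
      using e(1) n(2) unfolding is_execution_def b_def by (auto simp: ereal_real)
    have dom: "traj_dom e 0 = {0..b}" "traj e 0 b \<in> G"
      using e(1) n(1) j0 unfolding is_execution_def Let_def b_def by auto
    show thesis
    proof (cases "b = 0")
      case True
      then show thesis using dom start by (intro guard) auto
    next
      case False
      with start dom have "0 < b" by auto
      then show thesis using seg(1,2) dom b by (intro arc[of b "traj e 0"]) auto
    qed
  qed
qed

lemma in_flow_set_or_guard: "x \<in> topspace X \<Longrightarrow> x \<in> F \<or> x \<in> G"
  by (erule first_arc) (use flow_domD in blast)+

text \<open>The first arc of an execution ends exactly when the flow stops being defined: were the flow
  still defined at the end \<open>b\<close> of the arc, then \<open>\<gamma> b = \<phi> b x\<close> would lie in the flow set and in the guard.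
  So the arc is a continuous extension of the orbit to its closed time interval.\<close>
lemma endpoint_path:
  assumes x: "x \<in> topspace X" and fin: "\<mu> x \<noteq> \<infinity>"
  shows "endpoint x \<in> G"
    and "continuous_map (top_of_set {0..hit_time x}) X (\<lambda>t. closed_flow t x)"
proof -
  have "endpoint x \<in> G \<and> continuous_map (top_of_set {0..hit_time x}) X (\<lambda>t. closed_flow t x)"
    using x
  proof (cases rule: first_arc)
    case guard
    have "continuous_map (top_of_set {0::real}) X (\<lambda>t. closed_flow t x)"
      by (rule continuous_map_eq[where f = "\<lambda>_. x"])
         (use guard x in \<open>auto simp: closed_flow_def guard_max_flow_time endpoint_guard\<close>)
    then show ?thesis using guard by (simp add: endpoint_guard guard_hit_time)
  next
    case forever
    have "ereal t < \<mu> x" for t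
      using forever[of "max t 0"] flow_dom_iff[OF x] by (metis ereal_less_eq(3) max.cobounded1 max.cobounded2 order_le_less_trans)
    then have "\<mu> x = \<infinity>" using ereal_top by (metis less_imp_le)
    with fin show ?thesis by simp
  next
    case (arc b \<gamma>)
    have "(b, x) \<notin> D"
    proof
      assume bD: "(b, x) \<in> D"
      have "\<gamma> b = \<phi> b x"
      proof (rule eq_at_right_end[OF hausdorff \<open>0 < b\<close> arc(3)])
        show "continuous_map (top_of_set {0..b}) X (\<lambda>t. \<phi> t x)"
          using arc(2) bD x by (intro continuous_flow_comp) (auto simp: less_le)
      qed (use arc(2) in auto)
      then show False using flow_in[OF bD] arc(4) det by (auto simp: deterministic_def)
    qed
    then have "\<not> ereal b < \<mu> x" using flow_dom_iff[OF x] \<open>0 < b\<close> by auto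
    moreover have "ereal t < \<mu> x" if "0 \<le> t" "t < b" for t
      using arc(2)[OF that] flow_dom_iff[OF x] by auto
    ultimately have cut: "ereal t < \<mu> x \<longleftrightarrow> t < b" if "0 \<le> t" for t
      using that by (meson ereal_less_eq(3) not_le order_le_less_trans)
    then have "\<mu> x = ereal b"
      using \<open>0 < b\<close> by (intro ereal_eq_if_same_lower_cut max_flow_time_nonneg) auto
    then have hb: "hit_time x = b" by (simp add: hit_time_def)
    have nG: "x \<notin> G" using arc(1,2) flow_domD[of 0 x] det by (auto simp: deterministic_def)
    have "\<gamma> b \<in> G \<and> continuous_map (top_of_set {0..hit_time x}) X
        (\<lambda>t. if ereal t < \<mu> x then \<phi> t x else \<gamma> b)"
    proof (rule conjI[OF arc(4)], rule continuous_map_eq[where f = \<gamma>])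
      show "continuous_map (top_of_set {0..hit_time x}) X \<gamma>" using arc(3) hb by simp
      fix t assume "t \<in> topspace (top_of_set {0..hit_time x})"
      then show "\<gamma> t = (if ereal t < \<mu> x then \<phi> t x else \<gamma> b)"
        using cut[of t] arc(2)[of t] hb by auto
    qed
    note chosen = someI[of "\<lambda>z. z \<in> G \<and> continuous_map (top_of_set {0..hit_time x}) X
        (\<lambda>t. if ereal t < \<mu> x then \<phi> t x else z)", OF this]
    have choice: "endpoint x = (SOME z. z \<in> G \<and> continuous_map (top_of_set {0..hit_time x}) X
        (\<lambda>t. if ereal t < \<mu> x then \<phi> t x else z))"
      using nG by (simp add: endpoint_def)
    show ?thesis unfolding closed_flow_def choice by (rule chosen)
  qed
  then show "endpoint x \<in> G" "continuous_map (top_of_set {0..hit_time x}) X (\<lambda>t. closed_flow t x)"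
    by auto
qed

lemma endpoint_flow:
  assumes s: "(s, x) \<in> D" and fin: "\<mu> x \<noteq> \<infinity>"
  shows "endpoint (\<phi> s x) = endpoint x"
proof -
  let ?y = "\<phi> s x"
  have x: "x \<in> topspace X" and s0: "0 \<le> s" and y: "?y \<in> topspace X"
    using flow_domD[OF s] flow_in[OF s] flow_set_subset by auto
  have finy: "\<mu> ?y \<noteq> \<infinity>" and ty: "hit_time ?y = hit_time x - s"
    using hit_time_flow[OF s fin] by auto
  have pos: "0 < hit_time ?y"
    using flow_dom_iff[OF x] s less_max_flow_time_iff[OF fin] ty by auto
  have "closed_flow (hit_time ?y) ?y = closed_flow (hit_time ?y + s) x"
  proof (rule eq_at_right_end[OF hausdorff pos])
    show "continuous_map (top_of_set {0..hit_time ?y}) X (\<lambda>t. closed_flow t ?y)"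
      by (rule endpoint_path(2)[OF y finy])
    show "continuous_map (top_of_set {0..hit_time ?y}) X (\<lambda>t. closed_flow (t + s) x)"
      by (rule continuous_map_comp[OF _ endpoint_path(2)[OF x fin]])
         (use s0 ty in \<open>auto simp: continuous_map_in_subtopology intro!: continuous_intros\<close>)
    fix t assume t: "0 \<le> t" "t < hit_time ?y"
    then have "(t + s, x) \<in> D" using flow_dom_iff[OF x] less_max_flow_time_iff[OF fin] ty s0 by auto
    from flow_add[OF t(1) s0 this] show "closed_flow t ?y = closed_flow (t + s) x"
      using t ty by (simp add: closed_flow_def less_max_flow_time_iff[OF fin] less_max_flow_time_iff[OF finy])
  qed
  then show ?thesis
    using ty by (simp add: closed_flow_def less_max_flow_time_iff[OF fin] less_max_flow_time_iff[OF finy])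
qed

end

section \<open>The suspension flow started in the state space\<close>

context complete_hybrid
begin

lemma advance_before: "ereal t < \<mu> x \<Longrightarrow> advance t x = q (Inl (\<phi> t x))"
  by (simp add: advance_def)

lemma advance_after:
  "\<mu> x \<noteq> \<infinity> \<Longrightarrow> hit_time x \<le> t \<Longrightarrow> advance t x = q (Inr (endpoint x, t - hit_time x))"
  by (simp add: advance_def less_max_flow_time_iff)

lemma advance_closed_flow:
  assumes "x \<in> topspace X" "\<mu> x \<noteq> \<infinity>" "t \<le> hit_time x"
  shows "advance t x = q (Inl (closed_flow t x))"
  using assms(3) q_bottom[OF endpoint_path(1)[OF assms(1,2)]]
  by (auto simp: advance_def closed_flow_def less_max_flow_time_iff[OF assms(2)] not_less)

lemma closed_flow_in:
  assumes "x \<in> topspace X" "0 \<le> t" shows "closed_flow t x \<in> topspace X"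
proof (cases "ereal t < \<mu> x")
  case True
  then have "(t, x) \<in> D" using assms flow_dom_iff by blast
  with True show ?thesis using flow_in flow_set_subset by (auto simp: closed_flow_def)
next
  case False
  then have "\<mu> x \<noteq> \<infinity>" by auto
  from endpoint_path(1)[OF assms(1) this] False show ?thesis
    using guard_subset by (auto simp: closed_flow_def)
qed

lemma advance_guard: "z \<in> G \<Longrightarrow> 0 \<le> t \<Longrightarrow> advance t z = q (Inr (z, t))"
  by (simp add: advance_def guard_max_flow_time guard_hit_time endpoint_guard)

lemma advance_zero: "x \<in> topspace X \<Longrightarrow> advance 0 x = q (Inl x)"
  using in_flow_set_or_guard[of x] flow_dom_iff[of x 0] zero_in_flow_dom[of x]
  by (auto simp: advance_guard q_bottom advance_before flow_zero)

text \<open>Flowing for time \<open>s\<close> shortens the hitting time by \<open>s\<close> and does not change the end point. This is the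
  semigroup law of \<open>advance\<close> before the guard is reached, and it transports continuity of \<open>advance\<close> from the
  guard backwards along orbits.\<close>
lemma advance_flow:
  assumes s: "(s, x) \<in> D" and t: "0 \<le> t"
  shows "advance (t + s) x = advance t (\<phi> s x)"
proof -
  have x: "x \<in> topspace X" and s0: "0 \<le> s" using flow_domD[OF s] flow_set_subset by auto
  have iff: "ereal (t + s) < \<mu> x \<longleftrightarrow> ereal t < \<mu> (\<phi> s x)"
    unfolding max_flow_time_flow[OF s] by (cases "\<mu> (\<phi> s x)") auto
  show ?thesis
  proof (cases "ereal (t + s) < \<mu> x")
    case True
    then have "(t + s, x) \<in> D" using flow_dom_iff[OF x] s0 t by simp
    then show ?thesis using True iff flow_add[OF t s0] by (simp add: advance_before)
  next
    case False
    then have "\<mu> x \<noteq> \<infinity>" by auto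
    then have "endpoint (\<phi> s x) = endpoint x" "t + s - hit_time x = t - hit_time (\<phi> s x)"
      using hit_time_flow[OF s] endpoint_flow[OF s] by auto
    then show ?thesis using False iff by (simp only: advance_def if_False)
  qed
qed

abbreviation advance_continuous where
  "advance_continuous S \<equiv>
     continuous_map (prod_topology (top_of_set {0..1}) (subtopology X S)) \<Sigma> (\<lambda>(t, x). advance t x)"

section \<open>From a suspension semiflow to the trapping guard condition\<close>

text \<open>The two properties required of the suspension semiflow, expressed by the single quotient map.\<close>
definition suspends where
  "suspends \<Phi> \<longleftrightarrow> continuous_semiflow \<Sigma> \<Phi> \<and>
     (\<forall>z\<in>G. \<forall>s\<in>{0..1}. \<forall>t\<in>{0..1 - s}. \<Phi> t (q (Inr (z, s))) = q (Inr (z, t + s))) \<and>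
     (\<forall>(t, x)\<in>D. q (Inl (\<phi> t x)) = \<Phi> t (q (Inl x)))"

lemma suspendsD:
  assumes "suspends \<Phi>"
  shows "continuous_map (nonneg_times \<Sigma>) \<Sigma> (\<lambda>(t, y). \<Phi> t y)"
    and "\<And>s t y. 0 \<le> s \<Longrightarrow> 0 \<le> t \<Longrightarrow> y \<in> topspace \<Sigma> \<Longrightarrow> \<Phi> (t + s) y = \<Phi> t (\<Phi> s y)"
    and "\<And>y. y \<in> topspace \<Sigma> \<Longrightarrow> \<Phi> 0 y = y"
    and "\<And>z t. z \<in> G \<Longrightarrow> 0 \<le> t \<Longrightarrow> t \<le> 1 \<Longrightarrow> \<Phi> t (q (Inl z)) = q (Inr (z, t))"
    and "\<And>t x. (t, x) \<in> D \<Longrightarrow> \<Phi> t (q (Inl x)) = q (Inl (\<phi> t x))"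
proof -
  have sf: "continuous_local_semiflow \<Sigma> ({0..} \<times> topspace \<Sigma>) \<Phi>"
    using assms by (simp add: suspends_def continuous_semiflow_def)
  have "subtopology (nonneg_times \<Sigma>) ({0..} \<times> topspace \<Sigma>) = nonneg_times \<Sigma>"
    using subtopology_topspace[of "nonneg_times \<Sigma>"] by simp
  then show "continuous_map (nonneg_times \<Sigma>) \<Sigma> (\<lambda>(t, y). \<Phi> t y)"
    using sf by (simp add: continuous_local_semiflow_def)
  show "\<Phi> (t + s) y = \<Phi> t (\<Phi> s y)" if "0 \<le> s" "0 \<le> t" "y \<in> topspace \<Sigma>" for s t y
    using sf that by (simp add: continuous_local_semiflow_def local_semiflow_def)
  show "\<Phi> 0 y = y" if "y \<in> topspace \<Sigma>" for y
    using sf that by (simp add: continuous_local_semiflow_def local_semiflow_def)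
  show "\<Phi> t (q (Inl z)) = q (Inr (z, t))" if "z \<in> G" "0 \<le> t" "t \<le> 1" for z t
  proof -
    have "\<forall>z\<in>G. \<forall>s\<in>{0..1}. \<forall>t\<in>{0..1 - s}. \<Phi> t (q (Inr (z, s))) = q (Inr (z, t + s))"
      using assms by (simp add: suspends_def)
    then have "\<Phi> t (q (Inr (z, 0))) = q (Inr (z, t + 0))" using that by force
    then show ?thesis using q_bottom[OF that(1)] by simp
  qed
  show "\<Phi> t (q (Inl x)) = q (Inl (\<phi> t x))" if "(t, x) \<in> D" for t x
    using assms that by (fastforce simp: suspends_def)
qed

text \<open>The curve \<open>c t = \<Phi> t (q (Inl x))\<close> is the image of the orbit of \<open>x\<close> up to the hitting time. Its value
  at the hitting time lies outside the open cylinder, which is open and not met earlier, hence in the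
  image of \<open>X\<close>. Now \<open>c\<close> stays in the neighbourhood that retracts onto \<open>X\<close>, and its retraction and the
  orbit, closed up by its end point, are two curves in the Hausdorff space \<open>X\<close> that agree before the
  hitting time.\<close>
lemma suspends_hits_endpoint:
  assumes \<Phi>: "suspends \<Phi>" and x: "x \<in> topspace X" and fin: "\<mu> x \<noteq> \<infinity>"
  shows "\<Phi> (hit_time x) (q (Inl x)) = q (Inl (endpoint x))"
proof (cases "hit_time x = 0")
  case True
  have "x \<in> G"
    using in_flow_set_or_guard[OF x] zero_in_flow_dom[of x] flow_dom_iff[OF x, of 0]
      less_max_flow_time_iff[OF fin, of 0] True by auto
  then show ?thesis
    using True suspendsD(4)[OF \<Phi>, of x 0] by (simp add: endpoint_guard q_bottom)
next
  case False
  then have pos: "0 < hit_time x" using hit_time_nonneg[of x] by simp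
  let ?I = "top_of_set {0..hit_time x}"
  define c where "c t = \<Phi> t (q (Inl x))" for t
  have qx: "q (Inl x) \<in> topspace \<Sigma>"
    using continuous_map_image_subset_topspace[OF continuous_q_Inl] x by auto
  have cc: "continuous_map ?I \<Sigma> c"
  proof -
    have "continuous_map ?I (nonneg_times \<Sigma>) (\<lambda>t. (t, q (Inl x)))"
      using qx by (intro continuous_map_pairedI continuous_map_into_subtopology) auto
    from continuous_map_comp[OF this suspendsD(1)[OF \<Phi>]] show ?thesis by (simp add: c_def[abs_def])
  qed
  have c_before: "c t = q (Inl (\<phi> t x))" "\<phi> t x \<in> topspace X" if "0 \<le> t" "t < hit_time x" for t
  proof -
    have "(t, x) \<in> D" using that flow_dom_iff[OF x] less_max_flow_time_iff[OF fin] by simp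
    then show "c t = q (Inl (\<phi> t x))" "\<phi> t x \<in> topspace X"
      using suspendsD(5)[OF \<Phi>] flow_in flow_set_subset by (auto simp: c_def)
  qed
  obtain k where cyl: "openin \<Sigma> open_cylinder" "\<And>x. x \<in> topspace X \<Longrightarrow> q (Inl x) \<notin> open_cylinder"
    using open_cylinder_chart by metis
  have "c (hit_time x) \<notin> open_cylinder"
  proof
    assume "c (hit_time x) \<in> open_cylinder"
    then obtain t where "0 \<le> t" "t < hit_time x" "c t \<in> open_cylinder"
      using open_meets_before_right_end[OF pos cc cyl(1)] by blast
    then show False using c_before cyl(2) by auto
  qed
  moreover have "c (hit_time x) \<in> topspace \<Sigma>"
    using continuous_map_image_subset_topspace[OF cc] pos by (auto simp: image_subset_iff)
  ultimately obtain z where z: "z \<in> topspace X" "c (hit_time x) = q (Inl z)"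
    by (meson suspension_cases)
  obtain N g where N: "openin \<Sigma> N" "continuous_map (subtopology \<Sigma> N) X g"
    "\<And>x. x \<in> topspace X \<Longrightarrow> q (Inl x) \<in> N \<and> g (q (Inl x)) = x"
    using state_space_neighbourhood_retract by blast
  have "c t \<in> N" if "t \<in> {0..hit_time x}" for t
    using that c_before[of t] z N(3) by (cases "t = hit_time x") auto
  then have "continuous_map ?I (subtopology \<Sigma> N) c"
    using cc by (intro continuous_map_into_subtopology) auto
  from continuous_map_comp[OF this N(2)]
  have "g (c (hit_time x)) = closed_flow (hit_time x) x"
    by (rule eq_at_right_end[OF hausdorff pos _ endpoint_path(2)[OF x fin]])
       (use c_before N(3) in \<open>auto simp: closed_flow_def less_max_flow_time_iff[OF fin]\<close>)
  then have "z = endpoint x"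
    using z N(3) by (simp add: closed_flow_def less_max_flow_time_iff[OF fin])
  with z(2) show ?thesis by (simp add: c_def)
qed

lemma suspends_imp_advance_continuous:
  assumes \<Phi>: "suspends \<Phi>" shows "advance_continuous UNIV"
proof (rule continuous_map_eq)
  let ?Z = "prod_topology (top_of_set {0..1::real}) (subtopology X UNIV)"
  have "continuous_map ?Z (nonneg_times \<Sigma>) (\<lambda>p. (fst p, q (Inl (snd p))))"
    by (intro continuous_map_pairedI continuous_map_into_subtopology continuous_map_fst_real
        continuous_map_comp[OF _ continuous_q_Inl])
       (auto simp only: subtopology_UNIV intro: continuous_map_snd, auto)
  from continuous_map_comp[OF this suspendsD(1)[OF \<Phi>]]
  show "continuous_map ?Z \<Sigma> (\<lambda>p. \<Phi> (fst p) (q (Inl (snd p))))" by simp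
  fix p assume "p \<in> topspace ?Z"
  then obtain t x where p: "p = (t, x)" "0 \<le> t" "t \<le> 1" and x: "x \<in> topspace X" by auto
  have qx: "q (Inl x) \<in> topspace \<Sigma>"
    using continuous_map_image_subset_topspace[OF continuous_q_Inl] x by auto
  have "\<Phi> t (q (Inl x)) = advance t x"
  proof (cases "ereal t < \<mu> x")
    case True
    then show ?thesis using suspendsD(5)[OF \<Phi>] flow_dom_iff[OF x] p by (simp add: advance_before)
  next
    case False
    then have fin: "\<mu> x \<noteq> \<infinity>" by auto
    then have ht: "hit_time x \<le> t" using False less_max_flow_time_iff by auto
    have "\<Phi> t (q (Inl x)) = \<Phi> (t - hit_time x) (\<Phi> (hit_time x) (q (Inl x)))"
      using suspendsD(2)[OF \<Phi> hit_time_nonneg[of x], of "t - hit_time x" "q (Inl x)"] ht qx by simp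
    also have "\<dots> = q (Inr (endpoint x, t - hit_time x))"
      unfolding suspends_hits_endpoint[OF \<Phi> x fin]
      using ht p hit_time_nonneg[of x] by (intro suspendsD(4)[OF \<Phi> endpoint_path(1)[OF x fin]]) auto
    finally show ?thesis using advance_after[OF fin ht] by simp
  qed
  then show "\<Phi> (fst p) (q (Inl (snd p))) = (case p of (t, x) \<Rightarrow> advance t x)" by (simp add: p)
qed

text \<open>Where \<open>hit_time\<close> is continuous, the points lying strictly beyond their hitting time form an
  open set, which is disjoint from the flow domain and so from its closure.\<close>
lemma flow_dom_closure_le_hit_time:
  assumes U: "openin X U" and fin: "\<And>x. x \<in> U \<Longrightarrow> \<mu> x \<noteq> \<infinity>"
    and cont: "continuous_map (subtopology X U) euclideanreal hit_time"
    and p: "(t, x) \<in> nonneg_times X closure_of D" "x \<in> U"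
  shows "t \<le> hit_time x"
proof (rule ccontr)
  assume "\<not> t \<le> hit_time x"
  let ?Z = "subtopology (nonneg_times X) ({0..} \<times> U)"
  let ?V = "{p \<in> topspace ?Z. hit_time (snd p) < fst p}"
  have "?Z = prod_topology (top_of_set {0..}) (subtopology X U)"
    by (simp add: subtopology_Times subtopology_subtopology)
  then have "openin ?Z ?V"
    by (intro openin_real_greater) (auto intro: continuous_map_fst_real continuous_map_comp[OF continuous_map_snd cont])
  moreover have "openin (nonneg_times X) ({0..} \<times> U)"
    using U by (simp add: openin_prod_Times_iff)
  ultimately have "openin (nonneg_times X) ?V" by (rule openin_trans_full)
  moreover have "?V \<inter> D = {}"
  proof -
    have False if "(u, y) \<in> D" "y \<in> U" "hit_time y < u" for u y
      using that flow_dom_iff[of y u] less_max_flow_time_iff[OF fin, of y u] flow_domD flow_set_subset by force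
    then show ?thesis by auto
  qed
  ultimately have "?V \<inter> nonneg_times X closure_of D = {}"
    by (simp add: openin_Int_closure_of_eq_empty)
  moreover have "(t, x) \<in> ?V"
    using p \<open>\<not> t \<le> hit_time x\<close> by (simp add: in_closure_of)
  ultimately show False using p(1) by blast
qed

text \<open>Time \<open>1/2\<close> separates the points close to the guard from the rest: within this time they have
  entered the cylinder and cannot have left it. The cylinder coordinates of \<open>advance (1/2) x\<close> are
  \<open>endpoint x\<close> and \<open>1/2 - hit_time x\<close>, which gives the retraction and the continuity of \<open>\<mu>\<close>. The extended
  flow is \<open>closed_flow\<close>, recovered from \<open>advance\<close> through the retraction onto \<open>X\<close>. It is the only
  extension because \<open>D \<inter> ([0,\<infinity>) \<times> U)\<close> is dense in \<open>C\<close>.\<close>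
lemma advance_continuous_imp_trapping_guard:
  assumes adv: "advance_continuous UNIV"
  shows "trapping_guard H"
proof -
  obtain k where k: "openin \<Sigma> open_cylinder" "continuous_map (subtopology \<Sigma> open_cylinder) cylinder k"
    "\<And>z s. z \<in> G \<Longrightarrow> 0 < s \<Longrightarrow> s < 1 \<Longrightarrow> k (q (Inr (z, s))) = (z, s)"
    "\<And>x. x \<in> topspace X \<Longrightarrow> q (Inl x) \<notin> open_cylinder"
    using open_cylinder_chart by blast
  have adv': "continuous_map (prod_topology (top_of_set {0..1}) X) \<Sigma> (\<lambda>(t, x). advance t x)"
    using adv by simp
  have half: "continuous_map X \<Sigma> (\<lambda>x. advance (1/2) x)"
  proof -
    have "continuous_map X (prod_topology (top_of_set {0..1}) X) (\<lambda>x. (1/2::real, x))"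
      by (intro continuous_map_pairedI) auto
    from continuous_map_comp[OF this adv'] show ?thesis by simp
  qed
  \<comment> \<open>Any time strictly between \<open>0\<close> and the height \<open>1\<close> of the cylinder would do.\<close>
  define U where "U = {x \<in> topspace X. advance (1/2) x \<in> open_cylinder}"
  have U: "openin X U" unfolding U_def by (rule openin_continuous_map_preimage[OF half k(1)])
  have GU: "G \<subseteq> U"
    using guard_subset by (auto simp: U_def advance_guard open_cylinder_def)
  have UX: "x \<in> topspace X" if "x \<in> U" for x using that by (simp add: U_def)
  have inU: "\<mu> x \<noteq> \<infinity> \<and> hit_time x < 1/2" if "x \<in> U" for x
  proof -
    have x: "x \<in> topspace X" "advance (1/2) x \<in> open_cylinder" using that by (auto simp: U_def)
    have nlt: "\<not> ereal (1/2) < \<mu> x"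
    proof
      assume lt: "ereal (1/2) < \<mu> x"
      then have "advance (1/2) x = q (Inl (closed_flow (1/2) x))"
        by (simp add: advance_def closed_flow_def)
      then show False using x(2) k(4)[OF closed_flow_in[OF x(1), of "1/2"]] by simp
    qed
    then have fin: "\<mu> x \<noteq> \<infinity>" by auto
    have "hit_time x \<noteq> 1/2"
    proof
      assume "hit_time x = 1/2"
      then have "advance (1/2) x = q (Inl (closed_flow (1/2) x))"
        using advance_closed_flow[OF x(1) fin] by simp
      then show False using x(2) k(4)[OF closed_flow_in[OF x(1), of "1/2"]] by simp
    qed
    then show ?thesis using fin nlt less_max_flow_time_iff[OF fin] by auto
  qed
  have chart: "k (advance (1/2) x) = (endpoint x, 1/2 - hit_time x)" if "x \<in> U" for x
    using inU[OF that] k(3)[OF endpoint_path(1)[OF UX[OF that]], of "1/2 - hit_time x"] hit_time_nonneg[of x]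
    by (simp add: advance_after)
  have kc: "continuous_map (subtopology X U) cylinder (\<lambda>x. k (advance (1/2) x))"
  proof (rule continuous_map_comp[OF _ k(2)])
    show "continuous_map (subtopology X U) (subtopology \<Sigma> open_cylinder) (\<lambda>x. advance (1/2) x)"
      unfolding continuous_map_in_subtopology
      using continuous_map_from_subtopology[OF half] by (auto simp: U_def)
  qed
  have endc: "continuous_map (subtopology X U) (subtopology X G) endpoint"
    by (rule continuous_map_eq[OF continuous_map_comp[OF kc continuous_map_fst]]) (simp add: chart)
  have hitc: "continuous_map (subtopology X U) euclideanreal hit_time"
  proof (rule continuous_map_eq)
    show "continuous_map (subtopology X U) euclideanreal (\<lambda>x. 1/2 - snd (k (advance (1/2) x)))"
      using continuous_map_into_fulltopology[OF continuous_map_comp[OF kc continuous_map_snd]]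
      by (intro continuous_map_diff) auto
  qed (simp add: chart)
  define C where "C = (nonneg_times X closure_of D) \<inter> ({0..} \<times> U)"
  have C_le: "0 \<le> t \<and> t \<le> hit_time x \<and> x \<in> U" if "(t, x) \<in> C" for t x
    using that flow_dom_closure_le_hit_time[OF U _ hitc] inU by (auto simp: C_def)
  define \<psi> where "\<psi> p = closed_flow (fst p) (snd p)" for p
  let ?ZC = "subtopology (nonneg_times X) C"
  have \<psi>: "continuous_map ?ZC X \<psi>"
  proof -
    obtain N g where N: "openin \<Sigma> N" "continuous_map (subtopology \<Sigma> N) X g"
      "\<And>x. x \<in> topspace X \<Longrightarrow> q (Inl x) \<in> N \<and> g (q (Inl x)) = x"
      using state_space_neighbourhood_retract by blast
    have eq: "advance (fst p) (snd p) = q (Inl (\<psi> p))" "\<psi> p \<in> topspace X" if "p \<in> C" for p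
      using C_le[of "fst p" "snd p"] that inU[of "snd p"] UX[of "snd p"]
      by (simp_all add: \<psi>_def advance_closed_flow closed_flow_in)
    have "fst p \<le> 1" if "p \<in> C" for p
      using C_le[of "fst p" "snd p"] that inU[of "snd p"] by auto
    then have "continuous_map ?ZC (prod_topology (top_of_set {0..1}) X) (\<lambda>p. (fst p, snd p))"
      by (intro continuous_map_pairedI continuous_map_into_subtopology continuous_map_from_subtopology
          continuous_map_fst_real continuous_map_snd) (auto simp: C_def)
    from continuous_map_comp[OF this adv']
    have "continuous_map ?ZC \<Sigma> (\<lambda>p. advance (fst p) (snd p))" by (simp add: split_beta)
    then have "continuous_map ?ZC (subtopology \<Sigma> N) (\<lambda>p. advance (fst p) (snd p))"
      using eq N(3) by (intro continuous_map_into_subtopology) auto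
    from continuous_map_comp[OF this N(2)] show ?thesis
      by (rule continuous_map_eq) (use eq N(3) in auto)
  qed
  have \<psi>D: "\<psi> (t, x) = \<phi> t x" if "(t, x) \<in> D" for t x
    using that flow_dom_iff[of x t] flow_domD flow_set_subset by (force simp: \<psi>_def closed_flow_def)
  have ext: "continuous_flow_extension H C \<psi>"
    unfolding continuous_flow_extension_def using \<psi> \<psi>D by auto
  have uniq: "\<psi>' p = \<psi> p" if ext': "continuous_flow_extension H C \<psi>'" and p: "p \<in> C" for \<psi>' p
  proof (rule forall_in_closure_of_eq[OF _ hausdorff _ \<psi>])
    show "continuous_map ?ZC X \<psi>'" using ext' by (simp add: continuous_flow_extension_def)
    show "\<psi>' p = \<psi> p" if "p \<in> C \<inter> D" for p
    proof (cases p)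
      case (Pair t x)
      then show ?thesis using ext' that \<psi>D[of t x] by (auto simp: continuous_flow_extension_def)
    qed
    have "openin (nonneg_times X) ({0..} \<times> U)"
      using U by (simp add: openin_prod_Times_iff)
    then have "C \<subseteq> nonneg_times X closure_of (({0..} \<times> U) \<inter> D)"
      unfolding C_def using openin_Int_closure_of_subset by fastforce
    moreover have "({0..} \<times> U) \<inter> D = C \<inter> D"
      using closure_of_subset[OF openin_subset[OF openin_flow_dom]] by (auto simp: C_def)
    ultimately show "p \<in> ?ZC closure_of (C \<inter> D)"
      using p by (auto simp: closure_of_subtopology)
  qed
  have retr: "retraction_maps (subtopology X U) (subtopology X G) endpoint id"
    unfolding retraction_maps_def using endc GU
    by (auto simp: endpoint_guard continuous_map_in_subtopology)
  have nbhd: "neighborhood_of_set X G U"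
    using U GU openin_subset by (auto simp: neighborhood_of_set_def)
  have on_C: "\<forall>(t, x) \<in> C. ((t, x) \<in> D \<longrightarrow> \<psi> (t, x) = \<phi> t x) \<and> (ereal t = \<mu> x \<longrightarrow> \<psi> (t, x) = endpoint x)"
    using \<psi>D by (auto simp: \<psi>_def closed_flow_def)
  have hitc': "continuous_map (subtopology X U) euclideanreal (\<lambda>x. real_of_ereal (\<mu> x))"
    using hitc by (simp add: hit_time_def[abs_def])
  show ?thesis
    unfolding trapping_guard_def Let_def
  proof (intro exI[of _ U] exI[of _ endpoint] exI[of _ \<psi>] conjI nbhd retr hitc'
      ext[unfolded C_def] on_C[unfolded C_def])
    show "\<forall>x\<in>U. \<mu> x \<noteq> \<infinity>" using inU by blast
    show "\<forall>\<psi>'. continuous_flow_extension H (nonneg_times X closure_of D \<inter> {0..} \<times> U) \<psi>' \<longrightarrow>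
        (\<forall>p\<in>nonneg_times X closure_of D \<inter> {0..} \<times> U. \<psi>' p = \<psi> p)"
      using uniq unfolding C_def by blast
  qed
qed

section \<open>From the trapping guard condition to continuity\<close>

lemma advance_continuous_on_open_cover:
  assumes "\<And>t x. 0 \<le> t \<Longrightarrow> t \<le> 1 \<Longrightarrow> x \<in> topspace X \<Longrightarrow> \<exists>V. openin (prod_topology (top_of_set {0..1}) X) V \<and>
      (t, x) \<in> V \<and> continuous_map (subtopology (prod_topology (top_of_set {0..1}) X) V) \<Sigma> (\<lambda>(t, x). advance t x)"
  shows "advance_continuous UNIV"
  unfolding subtopology_UNIV by (rule continuous_map_locally) (use assms in auto)

lemma closed_orbit_in_closure:
  assumes x: "x \<in> F" and fin: "\<mu> x \<noteq> \<infinity>" and t: "0 \<le> t" "t \<le> hit_time x"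
  shows "(t, x) \<in> nonneg_times X closure_of D"
proof -
  have xX: "x \<in> topspace X" using x flow_set_subset by auto
  have pos: "0 < hit_time x"
    using zero_in_flow_dom[OF x] flow_dom_iff[OF xX, of 0] less_max_flow_time_iff[OF fin, of 0] by simp
  let ?I = "top_of_set {0..hit_time x}"
  have "continuous_map ?I (nonneg_times X) (\<lambda>t. (t, x))"
    using xX by (intro continuous_map_pairedI continuous_map_into_subtopology) auto
  then have "(\<lambda>t. (t, x)) ` (?I closure_of {0..<hit_time x})
      \<subseteq> nonneg_times X closure_of ((\<lambda>t. (t, x)) ` {0..<hit_time x})"
    by (rule continuous_map_image_closure_subset)
  also have "\<dots> \<subseteq> nonneg_times X closure_of D"
    by (rule closure_of_mono) (auto simp: flow_dom_iff[OF xX] less_max_flow_time_iff[OF fin])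
  also have "?I closure_of {0..<hit_time x} = {0..hit_time x}"
    using pos right_end_in_closure[OF pos] closure_of_subset[of "{0..<hit_time x}" ?I]
      closure_of_subset_topspace[of ?I "{0..<hit_time x}"] by force
  finally show ?thesis using t by auto
qed

text \<open>The retraction \<open>\<rho>\<close> equals \<open>endpoint\<close>, since both are limits of the same orbits. Over an open
  neighbourhood \<open>W\<close> of the guard, the strip \<open>[0,1] \<times> W\<close> is cut by the hitting time into two closed parts. In
  the later part, continuity is that of \<open>\<rho>\<close> and \<open>\<mu>\<close>. In the earlier part it is that of the extended flow
  \<open>\<psi>\<close>, except that a guard point which is not a limit of the flow set has no neighbour in the closure of the
  flow domain; the closed piece over \<open>G\<close>, where \<open>closed_flow\<close> does not move, covers these points.\<close>
lemma advance_continuous_near_guard: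
  assumes tg: "trapping_guard H"
  obtains W where "openin X W" "G \<subseteq> W" "advance_continuous W"
proof -
  obtain U \<rho> where nb: "neighborhood_of_set X G U"
    and retr: "retraction_maps (subtopology X U) (subtopology X G) \<rho> id"
    and fin: "\<forall>x\<in>U. \<mu> x \<noteq> \<infinity>"
    and hit: "continuous_map (subtopology X U) euclideanreal (\<lambda>x. real_of_ereal (\<mu> x))"
    and "\<exists>\<psi>. continuous_flow_extension H (nonneg_times X closure_of D \<inter> {0..} \<times> U) \<psi> \<and>
       (\<forall>(t, x)\<in>nonneg_times X closure_of D \<inter> {0..} \<times> U. ereal t = \<mu> x \<longrightarrow> \<psi> (t, x) = \<rho> x)"
    using tg unfolding trapping_guard_def Let_def by (elim exE conjE) fastforce
  then obtain \<psi> where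
    ext: "continuous_flow_extension H (nonneg_times X closure_of D \<inter> {0..} \<times> U) \<psi>"
    and \<psi>\<rho>: "\<And>t x. (t, x) \<in> nonneg_times X closure_of D \<inter> {0..} \<times> U \<Longrightarrow> ereal t = \<mu> x \<Longrightarrow> \<psi> (t, x) = \<rho> x"
    by blast
  obtain W where W: "openin X W" "G \<subseteq> W" "W \<subseteq> U" and UX: "U \<subseteq> topspace X"
    using nb by (auto simp: neighborhood_of_set_def)
  define C where "C = nonneg_times X closure_of D \<inter> {0..} \<times> U"
  have \<psi>: "continuous_map (subtopology (nonneg_times X) C) X \<psi>"
    and \<psi>D: "\<And>t x. (t, x) \<in> D \<Longrightarrow> x \<in> U \<Longrightarrow> \<psi> (t, x) = \<phi> t x"
  proof -
    show "continuous_map (subtopology (nonneg_times X) C) X \<psi>"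
      using ext by (simp add: continuous_flow_extension_def C_def)
    fix t x assume tx: "(t, x) \<in> D" "x \<in> U"
    have "(t, x) \<in> C"
      using closure_of_subset[OF openin_subset[OF openin_flow_dom]] flow_domD[OF tx(1)] tx
      by (auto simp: C_def)
    then show "\<psi> (t, x) = \<phi> t x" using ext tx(1) by (auto simp: continuous_flow_extension_def C_def)
  qed
  have hitU: "continuous_map (subtopology X U) euclideanreal hit_time"
    using hit by (simp add: hit_time_def[abs_def])
  have in_C: "(t, x) \<in> C" if "x \<in> F" "x \<in> U" "0 \<le> t" "t \<le> hit_time x" for t x
    using closed_orbit_in_closure[of x t] that fin by (auto simp: C_def)
  have mu_hit: "\<mu> x = ereal (hit_time x)" if "x \<in> U" for x
    using fin that max_flow_time_nonneg[of x] unfolding hit_time_def by (cases "\<mu> x") auto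
  \<comment> \<open>Off the guard, compare the extended flow \<open>\<psi>\<close> and the closed orbit of \<open>x\<close> at the hitting time.\<close>
  have end\<rho>: "endpoint x = \<rho> x" if xU: "x \<in> U" for x
  proof (cases "x \<in> G")
    case True
    then show ?thesis using retr guard_subset by (auto simp: endpoint_guard retraction_maps_def)
  next
    case False
    have x: "x \<in> topspace X" and finx: "\<mu> x \<noteq> \<infinity>" using xU UX fin by auto
    then have xF: "x \<in> F" using False in_flow_set_or_guard by auto
    have pos: "0 < hit_time x"
      using zero_in_flow_dom[OF xF] flow_dom_iff[OF x, of 0] less_max_flow_time_iff[OF finx, of 0] by simp
    let ?I = "top_of_set {0..hit_time x}"
    have "continuous_map ?I (subtopology (nonneg_times X) C) (\<lambda>t. (t, x))"
      using x in_C[OF xF xU]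
      by (intro continuous_map_pairedI continuous_map_into_subtopology) auto
    from continuous_map_comp[OF this \<psi>]
    have "\<psi> (hit_time x, x) = closed_flow (hit_time x) x"
      by (rule eq_at_right_end[OF hausdorff pos _ endpoint_path(2)[OF x finx]])
         (use \<psi>D xU flow_dom_iff[OF x] less_max_flow_time_iff[OF finx] in \<open>auto simp: closed_flow_def\<close>)
    moreover have "\<psi> (hit_time x, x) = \<rho> x"
      using \<psi>\<rho>[of "hit_time x" x] in_C[OF xF xU, of "hit_time x"] pos mu_hit[OF xU] by (simp add: C_def)
    ultimately show ?thesis by (simp add: closed_flow_def less_max_flow_time_iff[OF finx])
  qed
  have endW: "continuous_map (subtopology X W) (subtopology X G) endpoint"
  proof (rule continuous_map_eq)
    show "continuous_map (subtopology X W) (subtopology X G) \<rho>"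
      using retr W(3) continuous_map_from_subtopology_mono unfolding retraction_maps_def by blast
  qed (use end\<rho> W(3) in auto)
  have hitW: "continuous_map (subtopology X W) euclideanreal hit_time"
    by (rule continuous_map_from_subtopology_mono[OF hitU W(3)])
  let ?Z = "prod_topology (top_of_set {0..1::real}) (subtopology X W)"
  let ?adv = "\<lambda>(t, x). advance t x"
  have hitZ: "continuous_map ?Z euclideanreal (\<lambda>p. hit_time (snd p))"
    by (rule continuous_map_comp[OF continuous_map_snd hitW])
  let ?A = "{p \<in> topspace ?Z. fst p \<le> hit_time (snd p)}" and ?B = "{p \<in> topspace ?Z. hit_time (snd p) \<le> fst p}"
  have "continuous_map ?Z \<Sigma> ?adv"
  proof (rule continuous_map_two_closed)
    show "closedin ?Z ?A" "closedin ?Z ?B"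
      by (intro closedin_real_le hitZ continuous_map_fst_real)+
    show "topspace ?Z \<subseteq> ?A \<union> ?B" by auto
    show "continuous_map (subtopology ?Z ?B) \<Sigma> ?adv"
    proof (rule continuous_map_eq)
      have "fst p - hit_time (snd p) \<in> {0..1}" if "p \<in> ?B" for p
        using that hit_time_nonneg[of "snd p"] by auto
      then have "continuous_map (subtopology ?Z ?B) cylinder (\<lambda>p. (endpoint (snd p), fst p - hit_time (snd p)))"
        by (intro continuous_map_pairedI continuous_map_into_subtopology[of _ euclideanreal] continuous_map_diff
            continuous_map_from_subtopology continuous_map_comp[OF continuous_map_snd endW] hitZ continuous_map_fst_real) auto
      from continuous_map_comp[OF this continuous_q_Inr]
      show "continuous_map (subtopology ?Z ?B) \<Sigma> (\<lambda>p. q (Inr (endpoint (snd p), fst p - hit_time (snd p))))" .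
    qed (use W(3) fin in \<open>auto simp: advance_after\<close>)
    let ?ZA = "subtopology ?Z ?A"
    \<comment> \<open>\<open>?A1\<close> carries the extended flow \<open>\<psi>\<close>; \<open>?A2\<close> catches guard points away from the flow set.\<close>
    let ?A1 = "{p \<in> topspace ?ZA. p \<in> nonneg_times X closure_of D}" and ?A2 = "{p \<in> topspace ?ZA. snd p \<in> G}"
    have sndZ: "continuous_map ?ZA X snd"
      using continuous_map_into_fulltopology[OF continuous_map_snd] by (rule continuous_map_from_subtopology)
    have incl: "continuous_map ?ZA (nonneg_times X) (\<lambda>p. (fst p, snd p))"
      by (intro continuous_map_pairedI continuous_map_into_subtopology[of _ euclideanreal] sndZ
          continuous_map_from_subtopology continuous_map_fst_real) auto
    have "continuous_map ?ZA X (\<lambda>p. closed_flow (fst p) (snd p))"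
    proof (rule continuous_map_two_closed)
      show "closedin ?ZA ?A1"
        using closedin_continuous_map_preimage[OF incl closedin_closure_of] by simp
      show "closedin ?ZA ?A2"
        using ths by (intro closedin_continuous_map_preimage[OF sndZ]) (simp add: topological_hybrid_system_def)
      show "topspace ?ZA \<subseteq> ?A1 \<union> ?A2"
      proof
        fix p assume p: "p \<in> topspace ?ZA"
        have "p \<in> ?A1" if "snd p \<notin> G"
          using closed_orbit_in_closure[of "snd p" "fst p"] in_flow_set_or_guard[of "snd p"] p that W(3) fin by auto
        then show "p \<in> ?A1 \<union> ?A2" using p by blast
      qed
      show "continuous_map (subtopology ?ZA ?A1) X (\<lambda>p. closed_flow (fst p) (snd p))"
      proof (rule continuous_map_eq)
        have "continuous_map (subtopology ?ZA ?A1) (subtopology (nonneg_times X) C) (\<lambda>p. (fst p, snd p))"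
          using W(3) unfolding continuous_map_in_subtopology[of _ _ C]
          by (intro conjI continuous_map_from_subtopology incl) (auto simp: C_def)
        from continuous_map_comp[OF this \<psi>]
        show "continuous_map (subtopology ?ZA ?A1) X \<psi>" by simp
        fix p assume p: "p \<in> topspace (subtopology ?ZA ?A1)"
        obtain t x where tx: "p = (t, x)" by (cases p)
        have x: "x \<in> W" "x \<in> U" "x \<in> topspace X" "0 \<le> t" "t \<le> hit_time x" "(t, x) \<in> C"
          using p tx W(3) UX by (auto simp: C_def)
        show "\<psi> p = closed_flow (fst p) (snd p)"
        proof (cases "t < hit_time x")
          case True
          then show ?thesis using x \<psi>D[of t x] flow_dom_iff[of x t] mu_hit[of x] by (simp add: tx closed_flow_def)
        next
          case False
          then show ?thesis using x \<psi>\<rho>[of t x] mu_hit[of x] end\<rho>[of x] by (simp add: tx closed_flow_def C_def)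
        qed
      qed
      show "continuous_map (subtopology ?ZA ?A2) X (\<lambda>p. closed_flow (fst p) (snd p))"
        by (rule continuous_map_eq[OF continuous_map_from_subtopology[OF sndZ]])
           (auto simp: closed_flow_def guard_max_flow_time endpoint_guard)
    qed
    from continuous_map_comp[OF this continuous_q_Inl]
    show "continuous_map ?ZA \<Sigma> ?adv"
      by (rule continuous_map_eq) (use W(3) UX fin in \<open>auto simp: advance_closed_flow\<close>)
  qed
  then show thesis using that W by blast
qed

text \<open>The points that the flow carries into \<open>W\<close> in time \<open>s\<close>: before time \<open>s\<close> the function \<open>advance\<close> is the
  flow, after it \<open>advance_flow\<close> reduces continuity to \<open>W\<close>.\<close>
lemma advance_continuous_before_guard:
  assumes W: "openin X W" "advance_continuous W" and s: "0 \<le> s"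
  shows "openin X {x \<in> F. (s, x) \<in> D \<and> \<phi> s x \<in> W}" (is "openin X ?V")
    and "advance_continuous {x \<in> F. (s, x) \<in> D \<and> \<phi> s x \<in> W}"
proof -
  let ?E = "{x \<in> topspace X. (s, x) \<in> D}"
  have "continuous_map X (nonneg_times X) (\<lambda>x. (s, x))"
    using s by (intro continuous_map_pairedI) auto
  from openin_continuous_map_preimage[OF this openin_flow_dom]
  have E: "openin X ?E" by simp
  have flowE: "continuous_map (subtopology X ?E) X (\<lambda>x. \<phi> s x)"
    by (rule continuous_flow_comp) (auto intro: continuous_map_from_subtopology)
  have Veq: "?V = {x \<in> topspace (subtopology X ?E). \<phi> s x \<in> W}"
    using flow_domD flow_set_subset by auto
  have "openin (subtopology X ?E) ?V"
    unfolding Veq by (rule openin_continuous_map_preimage[OF flowE W(1)])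
  then show V: "openin X ?V" using E by (rule openin_trans_full)
  let ?Z = "prod_topology (top_of_set {0..1::real}) (subtopology X ?V)"
  have VX: "?V \<subseteq> topspace X" using flow_set_subset by auto
  have sndX: "continuous_map ?Z X snd"
    using continuous_map_into_fulltopology[OF continuous_map_snd] .
  let ?A = "{p \<in> topspace ?Z. fst p \<le> s}" and ?B = "{p \<in> topspace ?Z. s \<le> fst p}"
  show "advance_continuous ?V"
  proof (rule continuous_map_two_closed)
    show "closedin ?Z ?A" "closedin ?Z ?B"
      by (intro closedin_real_le continuous_map_fst_real; simp)+
    show "topspace ?Z \<subseteq> ?A \<union> ?B" by auto
    have before: "(t, x) \<in> D" if "(s, x) \<in> D" "0 \<le> t" "t \<le> s" for t x
      using that flow_dom_add[of "s - t" t x] flow_domD by auto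
    show "continuous_map (subtopology ?Z ?A) \<Sigma> (\<lambda>(t, x). advance t x)"
    proof (rule continuous_map_eq)
      show "continuous_map (subtopology ?Z ?A) \<Sigma> (\<lambda>p. q (Inl (\<phi> (fst p) (snd p))))"
        by (rule continuous_map_comp[OF continuous_flow_comp continuous_q_Inl])
           (use before in \<open>auto intro!: continuous_map_from_subtopology continuous_map_fst_real sndX\<close>)
      show "q (Inl (\<phi> (fst p) (snd p))) = (case p of (t, x) \<Rightarrow> advance t x)"
        if "p \<in> topspace (subtopology ?Z ?A)" for p
        using that before[of "snd p" "fst p"] flow_dom_iff[of "snd p" "fst p"] by (auto simp: advance_before)
    qed
    show "continuous_map (subtopology ?Z ?B) \<Sigma> (\<lambda>(t, x). advance t x)"
    proof (rule continuous_map_eq)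
      have "continuous_map ?Z X (\<lambda>p. \<phi> s (snd p))"
        by (rule continuous_map_comp[OF continuous_map_snd continuous_map_from_subtopology_mono[OF flowE]])
           (use VX in auto)
      then have "continuous_map (subtopology ?Z ?B) (subtopology X W) (\<lambda>p. \<phi> s (snd p))"
        unfolding continuous_map_in_subtopology by (auto intro: continuous_map_from_subtopology)
      moreover have "continuous_map (subtopology ?Z ?B) (top_of_set {0..1}) (\<lambda>p. fst p - s)"
        using s by (intro continuous_map_into_subtopology continuous_map_diff continuous_map_from_subtopology
            continuous_map_fst_real) auto
      ultimately have "continuous_map (subtopology ?Z ?B) (prod_topology (top_of_set {0..1}) (subtopology X W))
          (\<lambda>p. (fst p - s, \<phi> s (snd p)))"
        by (intro continuous_map_pairedI)
      from continuous_map_comp[OF this W(2)]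
      show "continuous_map (subtopology ?Z ?B) \<Sigma> (\<lambda>p. advance (fst p - s) (\<phi> s (snd p)))" by simp
      show "advance (fst p - s) (\<phi> s (snd p)) = (case p of (t, x) \<Rightarrow> advance t x)"
        if "p \<in> topspace (subtopology ?Z ?B)" for p
        using that advance_flow[of s "snd p" "fst p - s"] by auto
    qed
  qed
qed

text \<open>Either the orbit of \<open>x\<close> has not stopped at time \<open>t\<close>, and openness of the flow domain suffices; or \<open>x\<close>
  is in the guard; or the orbit converges to the guard and so enters \<open>W\<close> before its hitting time.\<close>
lemma trapping_guard_imp_advance_continuous:
  assumes tg: "trapping_guard H" shows "advance_continuous UNIV"
proof (rule advance_continuous_on_open_cover)
  obtain W where W: "openin X W" "G \<subseteq> W" "advance_continuous W"
    using advance_continuous_near_guard[OF tg] by blast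
  let ?Z = "prod_topology (top_of_set {0..1::real}) X" and ?adv = "\<lambda>(t, x). advance t x"
  have strip: "openin ?Z ({0..1} \<times> V) \<and> continuous_map (subtopology ?Z ({0..1} \<times> V)) \<Sigma> ?adv"
    if "openin X V" "advance_continuous V" for V
    using that openin_topspace[of "top_of_set {0..1::real}"]
    by (simp add: openin_prod_Times_iff subtopology_Times subtopology_subtopology)
  fix t :: real and x assume t: "0 \<le> t" "t \<le> 1" and x: "x \<in> topspace X"
  show "\<exists>V. openin ?Z V \<and> (t, x) \<in> V \<and> continuous_map (subtopology ?Z V) \<Sigma> ?adv"
  proof (cases "ereal t < \<mu> x")
    case True
    let ?V = "{p \<in> topspace ?Z. p \<in> D}"
    have "continuous_map ?Z (nonneg_times X) (\<lambda>p. (fst p, snd p))"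
      by (intro continuous_map_pairedI continuous_map_into_subtopology continuous_map_fst_real
          continuous_map_snd) auto
    from openin_continuous_map_preimage[OF this openin_flow_dom] have "openin ?Z ?V" by simp
    moreover have "continuous_map (subtopology ?Z ?V) \<Sigma> ?adv"
    proof (rule continuous_map_eq)
      show "continuous_map (subtopology ?Z ?V) \<Sigma> (\<lambda>p. q (Inl (\<phi> (fst p) (snd p))))"
        by (rule continuous_map_comp[OF continuous_flow_comp continuous_q_Inl])
           (auto intro!: continuous_map_from_subtopology continuous_map_fst_real continuous_map_snd)
    qed (auto simp: advance_before flow_dom_iff)
    ultimately show ?thesis using True t x flow_dom_iff[OF x, of t] by (intro exI[of _ ?V]) auto
  next
    case False
    then have fin: "\<mu> x \<noteq> \<infinity>" by auto
    show ?thesis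
    proof (cases "x \<in> G")
      case True
      then show ?thesis using strip[OF W(1,3)] t W(2) by (intro exI[of _ "{0..1} \<times> W"]) auto
    next
      case notG: False
      then have xF: "x \<in> F" using in_flow_set_or_guard[OF x] by auto
      have pos: "0 < hit_time x"
        using zero_in_flow_dom[OF xF] flow_dom_iff[OF x, of 0] less_max_flow_time_iff[OF fin, of 0] by simp
      have "closed_flow (hit_time x) x \<in> W"
        using endpoint_path(1)[OF x fin] W(2) by (auto simp: closed_flow_def less_max_flow_time_iff[OF fin])
      then obtain s where s: "0 \<le> s" "s < hit_time x" "closed_flow s x \<in> W"
        using open_meets_before_right_end[OF pos endpoint_path(2)[OF x fin] W(1)] by blast
      then have "x \<in> {x \<in> F. (s, x) \<in> D \<and> \<phi> s x \<in> W}"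
        using xF flow_dom_iff[OF x, of s] by (auto simp: closed_flow_def less_max_flow_time_iff[OF fin])
      then show ?thesis
        using strip[OF advance_continuous_before_guard[OF W(1,3) s(1)]] t
        by (intro exI[of _ "{0..1} \<times> {x \<in> F. (s, x) \<in> D \<and> \<phi> s x \<in> W}"]) auto
    qed
  qed
qed

section \<open>From continuity to the suspension semiflow\<close>

text \<open>On the disjoint union, time \<open>t \<le> 1\<close> acts on the state space by \<open>advance\<close> and on the cylinder by
  climbing, followed after the top by a reset and \<open>advance\<close>. Since \<open>[0,1]\<close> is locally compact Hausdorff, the
  product of \<open>q\<close> with the identity of \<open>[0,1]\<close> is a quotient map, so this descends to a continuous
  unit-time semiflow on the suspension.\<close>
lemma advance_continuous_imp_suspends:
  assumes adv: "advance_continuous UNIV" shows "\<exists>\<Phi>. suspends \<Phi>"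
proof -
  have adv': "continuous_map (prod_topology (top_of_set {0..1}) X) \<Sigma> (\<lambda>(t, x). advance t x)"
    using adv by simp
  define step where "step t a = (case a of Inl x \<Rightarrow> advance t x
      | Inr (z, s) \<Rightarrow> if s + t \<le> 1 then q (Inr (z, s + t)) else advance (s + t - 1) (r z))" for t a
  let ?I = "top_of_set {0..1::real}"
  have stepc: "continuous_map (prod_topology ?I (cylinder_sum H)) \<Sigma> (\<lambda>(t, a). step t a)"
    unfolding cylinder_sum_eq
  proof (rule continuous_map_times_disjoint_union)
    show "continuous_map (prod_topology ?I X) \<Sigma> (\<lambda>(t, x). case (t, Inl x) of (t, a) \<Rightarrow> step t a)"
      using adv' by (simp add: step_def)
    let ?Z = "prod_topology ?I cylinder"
    have time: "continuous_map ?Z euclideanreal (\<lambda>p. snd (snd p) + fst p)"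
      by (intro continuous_map_add continuous_map_fst_real
          continuous_map_comp[OF continuous_map_snd continuous_map_into_fulltopology[OF continuous_map_snd]])
    have base: "continuous_map ?Z (subtopology X G) (\<lambda>p. fst (snd p))"
      by (rule continuous_map_comp[OF continuous_map_snd continuous_map_fst])
    have "continuous_map ?Z \<Sigma> (\<lambda>p. if snd (snd p) + fst p \<le> 1 then q (Inr (fst (snd p), snd (snd p) + fst p))
        else advance (snd (snd p) + fst p - 1) (r (fst (snd p))))"
    proof (rule continuous_map_cases_le[OF time])
      let ?A = "{p. p \<in> topspace ?Z \<and> snd (snd p) + fst p \<le> 1}" and ?B = "{p. p \<in> topspace ?Z \<and> 1 \<le> snd (snd p) + fst p}"
      show "continuous_map ?Z euclideanreal (\<lambda>p. 1)" by simp
      have "continuous_map (subtopology ?Z ?A) cylinder (\<lambda>p. (fst (snd p), snd (snd p) + fst p))"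
        by (intro continuous_map_pairedI continuous_map_from_subtopology[OF base]
            continuous_map_into_subtopology[of _ euclideanreal] continuous_map_from_subtopology[OF time]) auto
      from continuous_map_comp[OF this continuous_q_Inr]
      show "continuous_map (subtopology ?Z ?A) \<Sigma> (\<lambda>p. q (Inr (fst (snd p), snd (snd p) + fst p)))" .
      have "continuous_map (subtopology ?Z ?B) (prod_topology ?I X) (\<lambda>p. (snd (snd p) + fst p - 1, r (fst (snd p))))"
        by (intro continuous_map_pairedI continuous_map_into_subtopology[of _ euclideanreal] continuous_map_diff
            continuous_map_from_subtopology[OF time]
            continuous_map_from_subtopology[OF continuous_map_comp[OF base continuous_reset]]) auto
      from continuous_map_comp[OF this adv']
      show "continuous_map (subtopology ?Z ?B) \<Sigma> (\<lambda>p. advance (snd (snd p) + fst p - 1) (r (fst (snd p))))"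
        by simp
      show "q (Inr (fst (snd p), snd (snd p) + fst p)) = advance (snd (snd p) + fst p - 1) (r (fst (snd p)))"
        if "p \<in> topspace ?Z" "snd (snd p) + fst p = 1" for p
        using that by (auto simp: q_top advance_zero reset_in)
    qed
    then show "continuous_map ?Z \<Sigma> (\<lambda>(t, p). case (t, Inr p) of (t, a) \<Rightarrow> step t a)"
      by (rule continuous_map_eq) (auto simp: step_def)
  qed
  have step_fib: "step t a = step t b"
    if "q a = q b" "a \<in> topspace (cylinder_sum H)" "b \<in> topspace (cylinder_sum H)" "0 \<le> t" "t \<le> 1" for t a b
  proof (rule q_eqD[OF that(1-3)])
    fix z assume z: "z \<in> G"
    show "step t (Inr (z, 0)) = step t (Inl z)" using that(4,5) z by (simp add: step_def advance_guard)
    show "step t (Inr (z, 1)) = step t (Inl (r z))"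
      using that(4,5) z by (auto simp: step_def q_top advance_zero reset_in)
  qed
  have quot: "quotient_map (prod_topology ?I (cylinder_sum H)) (prod_topology ?I \<Sigma>) (\<lambda>(t, a). (t, q a))"
    by (rule quotient_map_prod_right[OF _ _ quotient_map_q])
       (auto intro: compact_imp_locally_compact_space Hausdorff_space_subtopology simp: compact_space_subtopology)
  obtain g where g: "continuous_map (prod_topology ?I \<Sigma>) \<Sigma> g"
    "\<And>p. p \<in> topspace (prod_topology ?I (cylinder_sum H)) \<Longrightarrow>
       g ((\<lambda>(t, a). (t, q a)) p) = (\<lambda>(t, a). step t a) p"
  proof (rule quotient_map_lift_exists[OF quot stepc])
    fix p p'
    assume "p \<in> topspace (prod_topology ?I (cylinder_sum H))" "p' \<in> topspace (prod_topology ?I (cylinder_sum H))"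
      and "(\<lambda>(t, a). (t, q a)) p = (\<lambda>(t, a). (t, q a)) p'"
    then show "(\<lambda>(t, a). step t a) p = (\<lambda>(t, a). step t a) p'"
      using step_fib[of "snd p" "snd p'" "fst p"] by (cases p; cases p') simp
  qed blast
  define \<Psi> where "\<Psi> t y = g (t, y)" for t y
  have \<Psi>: "\<Psi> t (q a) = step t a" if "0 \<le> t" "t \<le> 1" "a \<in> topspace (cylinder_sum H)" for t a
    using g(2)[of "(t, a)"] that by (simp add: \<Psi>_def)
  have \<Psi>c: "continuous_map (prod_topology ?I \<Sigma>) \<Sigma> (\<lambda>(t, y). \<Psi> t y)"
    using g(1) by (simp add: \<Psi>_def)
  have X_in: "Inl x \<in> topspace (cylinder_sum H)" if "x \<in> topspace X" for x
    using that by (auto simp: topspace_cylinder_sum)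
  have G_in: "Inr (z, s) \<in> topspace (cylinder_sum H)" if "z \<in> G" "0 \<le> s" "s \<le> 1" for z s
    using that by (auto simp: topspace_cylinder_sum)
  have \<Psi>X: "\<Psi> t (q (Inl x)) = advance t x" if "0 \<le> t" "t \<le> 1" "x \<in> topspace X" for t x
    using that by (simp add: \<Psi> X_in step_def)
  have \<Psi>G: "\<Psi> t (q (Inr (z, s))) = (if s + t \<le> 1 then q (Inr (z, s + t)) else advance (s + t - 1) (r z))"
    if "0 \<le> t" "t \<le> 1" "z \<in> G" "0 \<le> s" "s \<le> 1" for t z s
    using that by (simp add: \<Psi> G_in step_def)
  have \<Psi>0: "\<Psi> 0 y = y" if "y \<in> topspace \<Sigma>" for y
    using that by (cases rule: suspension_point_cases) (simp_all add: \<Psi>X \<Psi>G advance_zero)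
  have advance_add: "\<Psi> t (advance s x) = advance (t + s) x"
    if "0 \<le> s" "0 \<le> t" "t + s \<le> 1" "x \<in> topspace X" for s t x
  proof (cases "ereal s < \<mu> x")
    case True
    then have sD: "(s, x) \<in> D" using flow_dom_iff that by blast
    then have "\<phi> s x \<in> topspace X" using flow_in flow_set_subset by blast
    then show ?thesis using True that advance_flow[OF sD] by (simp add: advance_before \<Psi>X)
  next
    case False
    then have fin: "\<mu> x \<noteq> \<infinity>" by auto
    then have ht: "hit_time x \<le> s" using False less_max_flow_time_iff by auto
    then have "\<Psi> t (advance s x) = q (Inr (endpoint x, s - hit_time x + t))"
      using that hit_time_nonneg[of x] endpoint_path(1)[OF that(4) fin]
      by (simp add: advance_after[OF fin] \<Psi>G)
    then show ?thesis using ht that by (simp add: advance_after[OF fin] algebra_simps)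
  qed
  have \<Psi>_add: "\<Psi> (t + s) y = \<Psi> t (\<Psi> s y)"
    if st: "0 \<le> s" "0 \<le> t" "t + s \<le> 1" and y: "y \<in> topspace \<Sigma>" for s t y
  proof -
    from y show ?thesis
    proof (cases rule: suspension_point_cases)
      case (state x)
      then show ?thesis using st state advance_add by (simp add: \<Psi>X)
    next
      case (cylinder z u)
      show ?thesis
      proof (cases "u + s \<le> 1")
        case True
        then show ?thesis using st cylinder by (simp add: \<Psi>G algebra_simps)
      next
        case False
        then have "\<Psi> t (\<Psi> s y) = \<Psi> t (advance (u + s - 1) (r z))" using st cylinder by (simp add: \<Psi>G)
        also have "\<dots> = advance (t + (u + s - 1)) (r z)"
          using False st cylinder by (intro advance_add) (auto simp: reset_in)
        finally show ?thesis using False st cylinder by (simp add: \<Psi>G algebra_simps)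
      qed
    qed
  qed
  obtain \<Phi> where \<Phi>: "continuous_semiflow \<Sigma> \<Phi>"
    "\<And>t y. 0 \<le> t \<Longrightarrow> t \<le> 1 \<Longrightarrow> y \<in> topspace \<Sigma> \<Longrightarrow> \<Phi> t y = \<Psi> t y"
    by (rule unit_time_extends_to_semiflow[OF \<Psi>c \<Psi>0 \<Psi>_add]) auto
  have q_in: "q a \<in> topspace \<Sigma>" if "a \<in> topspace (cylinder_sum H)" for a
    using that quotient_imp_surjective_map[OF quotient_map_q] by blast
  \<comment> \<open>Long stretches of flow are cut into unit steps, where \<open>\<Phi>\<close> is given by \<open>advance\<close>.\<close>
  have \<Phi>_flow: "(t, x) \<in> D \<Longrightarrow> t \<le> real n + 1 \<Longrightarrow> \<Phi> t (q (Inl x)) = q (Inl (\<phi> t x))" for n t x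
  proof (induction n arbitrary: t x)
    case 0
    then have "0 \<le> t" "x \<in> topspace X" using flow_domD flow_set_subset by blast+
    then show ?case
      using 0 flow_dom_iff[of x t] by (simp add: \<Phi>(2) \<Psi>X q_in X_in advance_before)
  next
    case (Suc n)
    have tx: "0 \<le> t" "x \<in> F" "x \<in> topspace X" using flow_domD[OF Suc.prems(1)] flow_set_subset by auto
    show ?case
    proof (cases "t \<le> 1")
      case True
      then show ?thesis
        using Suc.prems tx flow_dom_iff[of x t] by (simp add: \<Phi>(2) \<Psi>X q_in X_in advance_before)
    next
      case False
      have split: "t = (t - 1) + 1" by simp
      have D1: "(1, x) \<in> D" "(t - 1, \<phi> 1 x) \<in> D"
        using flow_dom_add[of "t - 1" 1 x] False tx Suc.prems by auto
      have "\<Phi> t (q (Inl x)) = \<Phi> (t - 1) (\<Phi> 1 (q (Inl x)))"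
        using \<Phi>(1) False q_in[OF X_in[OF tx(3)]] split
        unfolding continuous_semiflow_def continuous_local_semiflow_def local_semiflow_def
        by (metis SigmaI atLeast_iff linorder_le_cases diff_ge_0_iff_ge tx(1) zero_le_one)
      also have "\<Phi> 1 (q (Inl x)) = q (Inl (\<phi> 1 x))"
        using D1(1) tx flow_dom_iff[of x 1] by (simp add: \<Phi>(2) \<Psi>X q_in X_in advance_before)
      also have "\<Phi> (t - 1) \<dots> = q (Inl (\<phi> (t - 1) (\<phi> 1 x)))"
        using Suc.IH[OF D1(2)] Suc.prems(2) by simp
      also have "\<phi> (t - 1) (\<phi> 1 x) = \<phi> t x"
        using flow_add[of "t - 1" 1 x] False Suc.prems(1) by simp
      finally show ?thesis .
    qed
  qed
  have "\<Phi> t (q (Inl x)) = q (Inl (\<phi> t x))" if "(t, x) \<in> D" for t x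
  proof -
    obtain n where "t < real n" using reals_Archimedean2 by blast
    then show ?thesis using \<Phi>_flow[OF that, of n] by simp
  qed
  moreover have "\<Phi> t (q (Inr (z, s))) = q (Inr (z, t + s))"
    if "z \<in> G" "s \<in> {0..1}" "t \<in> {0..1 - s}" for z s t
    using that by (simp add: \<Phi>(2) q_in G_in \<Psi>G add.commute)
  ultimately have "suspends \<Phi>" using \<Phi>(1) unfolding suspends_def by auto
  then show ?thesis by blast
qed

theorem suspends_iff_trapping_guard: "(\<exists>\<Phi>. suspends \<Phi>) \<longleftrightarrow> trapping_guard H"
  using suspends_imp_advance_continuous advance_continuous_imp_trapping_guard
    trapping_guard_imp_advance_continuous advance_continuous_imp_suspends by blast

end

theorem corollary5:
  fixes H :: "'a hybrid_system"
  assumes "topological_hybrid_system H"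
    and "Hausdorff_space (state_space H)"
    and "deterministic H"
    and "\<And>x. x \<in> topspace (state_space H) \<Longrightarrow>
           \<exists>e. is_execution H e \<and> starts_at e x \<and> (infinite_execution e \<or> zeno_execution e)"
  shows "(\<exists>\<Phi>. continuous_semiflow (suspension H) \<Phi> \<and>
            (\<forall>z\<in>guard H. \<forall>s\<in>{0..1}. \<forall>t\<in>{0..1 - s}.
               \<Phi> t ((pi_susp H \<circ> pi0 H) (Inr (z, s))) = (pi_susp H \<circ> pi0 H) (Inr (z, t + s))) \<and>
            (\<forall>(t, x)\<in>flow_dom H.
               (pi_susp H \<circ> iota H) (flow H t x) = \<Phi> t ((pi_susp H \<circ> iota H) x)))
         \<longleftrightarrow> trapping_guard H"
proof -
  interpret complete_hybrid H
    using assms by (intro complete_hybrid.intro hybrid.intro complete_hybrid_axioms.intro)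
  have "(pi_susp H \<circ> iota H) x = q (Inl x)" for x
    by (simp add: q_def iota_def)
  then show ?thesis
    using suspends_iff_trapping_guard by (simp add: suspends_def q_def)
qed

end
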